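(* Let $p$ be a prime and let $r$ be a positive integer. Then there exists a sequence $(\Sigma_n)_{n=1}^{\infty}$, where each $\Sigma_n = (\sigma_{n,1},\ldots,\sigma_{n,n})$ is an $n$-tuple of subsets of $[n]$, such that if $X_n$ is the Haar-random matrix in $\mathrm{M}_n(\mathbb{Z}_p)$ supported on $\Sigma_n$, then $\mathrm{cok}(X_n)$ converges to the Cohen--Lenstra distribution in rank $r$, but does not converge to the Cohen--Lenstra distribution in rank $0$.
   Context: $[n] = \{1,\ldots,n\}$; $\mathbb{Z}_p$ is the ring of $p$-adic integers, $\mathbb{F}_p$ the field with $p$ elements, and $\mathrm{cok}(A) = \mathbb{Z}_p^n / A\mathbb{Z}_p^n$ for $A \in \mathrm{M}_n(\mathbb{Z}_p)$. A $\mathbb{Z}_p$-valued random variable is Haar-random if it is distributed according to the Haar probability measure on $\mathbb{Z}_p$. For subsets $\sigma_{n,1},\ldots,\sigma_{n,n}$ of $[n]$ and $\Sigma_n = (\sigma_{n,1},\ldots,\sigma_{n,n})$, the Haar-random matrix supported on $\Sigma_n$ is the random matrix $X_n \in \mathrm{M}_n(\mathbb{Z}_p)$ whose entries $(X_n)_{i,j}$ (row $i$, column $j$) with $i \in \sigma_{n,j}$ are Haar-random and independent, and $(X_n)_{i,j} = 0$ whenever $i \notin \sigma_{n,j}$. For an integer $m \ge 0$ put $\mathrm{cl}(m) = p^{-m^2}\prod_{i=1}^{m}(1-p^{-i})^{-2}\prod_{i=1}^{\infty}(1-p^{-i})$. A sequence $(Y_n)_{n\ge1}$ of random finitely generated $\mathbb{Z}_p$-modules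 converges to the Cohen--Lenstra distribution in rank $m$ if $\lim_{n\to\infty}\mathbb{P}(Y_n/pY_n \cong \mathbb{F}_p^m) = \mathrm{cl}(m)$. *)

theory Defs
  imports
    "HOL-Probability.Probability"
    "HOL-Algebra.AbelCoset"
    "HOL-Algebra.Module"
    "HOL-Number_Theory.Residues"
begin

section \<open>The ring of p-adic integers\<close>

text \<open>
  The inverse limit of the rings \<open>\<int>/p\<^sup>k\<int>\<close>: a p-adic integer is the sequence of its least
  nonnegative residues modulo \<open>p\<^sup>k\<close>.
\<close>

definition Zp :: "nat \<Rightarrow> (nat \<Rightarrow> int) ring" where
  "Zp p = \<lparr>carrier = {x. \<forall>k. x k \<in> {0..<int p ^ k} \<and> x (Suc k) mod int p ^ k = x k},
           monoid.mult = (\<lambda>x y k. (x k * y k) mod int p ^ k),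
           one = (\<lambda>k. 1 mod int p ^ k),
           zero = (\<lambda>k. 0),
           add = (\<lambda>x y k. (x k + y k) mod int p ^ k)\<rparr>"

text \<open>
  The type \<^typ>\<open>nat \<Rightarrow> int\<close> carries the product of the discrete topologies, whose restriction to
  the carrier is the p-adic topology.
\<close>

definition Zp_borel :: "nat \<Rightarrow> (nat \<Rightarrow> int) measure" where
  "Zp_borel p = restrict_space borel (carrier (Zp p))"

definition is_haar_prob :: "nat \<Rightarrow> (nat \<Rightarrow> int) measure \<Rightarrow> bool" where
  "is_haar_prob p M \<longleftrightarrow> prob_space M \<and> sets M = sets (Zp_borel p) \<and>
     (\<forall>a\<in>carrier (Zp p). distr M M (\<lambda>x. a \<oplus>\<^bsub>Zp p\<^esub> x) = M)"

definition haar :: "nat \<Rightarrow> (nat \<Rightarrow> int) measure" where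
  "haar p = (THE M. is_haar_prob p M)"


section \<open>Modules\<close>

text \<open>
  In \<^typ>\<open>('a, 'b) module\<close> records the inherited ring fields \<open>mult\<close> and \<open>one\<close> are irrelevant.
\<close>

text \<open>\<open>S\<^sup>n\<close>, indexed by \<open>{1..n}\<close>, with scalars acting through \<open>\<phi>\<close>.\<close>

definition coord_module :: "('a \<Rightarrow> 'b) \<Rightarrow> ('b, 'c) ring_scheme \<Rightarrow> nat \<Rightarrow> ('a, nat \<Rightarrow> 'b) module" where
  "coord_module \<phi> S n =
     \<lparr>carrier = {1..n} \<rightarrow>\<^sub>E carrier S, monoid.mult = undefined, one = undefined,
      zero = (\<lambda>i\<in>{1..n}. \<zero>\<^bsub>S\<^esub>),
      add = (\<lambda>v w. \<lambda>i\<in>{1..n}. v i \<oplus>\<^bsub>S\<^esub> w i),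
      smult = (\<lambda>a v. \<lambda>i\<in>{1..n}. \<phi> a \<otimes>\<^bsub>S\<^esub> v i)\<rparr>"

definition quot_module :: "('a, 'b) module \<Rightarrow> 'b set \<Rightarrow> ('a, 'b set) module" where
  "quot_module M N =
     \<lparr>carrier = a_rcosets\<^bsub>M\<^esub> N, monoid.mult = undefined, one = undefined,
      zero = N, add = set_add M,
      smult = (\<lambda>a C. \<Union>x\<in>C. N +>\<^bsub>M\<^esub> (a \<odot>\<^bsub>M\<^esub> x))\<rparr>"

definition module_isomorphic ::
    "('a, 'r) ring_scheme \<Rightarrow> ('a, 'b) module \<Rightarrow> ('a, 'c) module \<Rightarrow> bool" where
  "module_isomorphic R M N \<longleftrightarrow>
     (\<exists>f \<in> iso (add_monoid M) (add_monoid N).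
        \<forall>a\<in>carrier R. \<forall>x\<in>carrier M. f (a \<odot>\<^bsub>M\<^esub> x) = a \<odot>\<^bsub>N\<^esub> f x)"

abbreviation Zp_vec :: "nat \<Rightarrow> nat \<Rightarrow> (nat \<Rightarrow> int, nat \<Rightarrow> nat \<Rightarrow> int) module" where
  "Zp_vec p n \<equiv> coord_module id (Zp p) n"

text \<open>\<open>\<bbbF>\<^sub>p\<^sup>m\<close> as a \<open>\<int>\<^sub>p\<close>-module: \<open>x 1\<close> is the reduction of \<open>x\<close> modulo \<open>p\<close>.\<close>

abbreviation Fp_vec :: "nat \<Rightarrow> nat \<Rightarrow> (nat \<Rightarrow> int, nat \<Rightarrow> int) module" where
  "Fp_vec p m \<equiv> coord_module (\<lambda>x. x 1) (residue_ring (int p)) m"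

text \<open>The quotient \<open>Y/pY\<close>, where \<open>[p] \<cdot> y\<close> is the p-fold sum of \<open>y\<close>.\<close>

definition mod_p :: "nat \<Rightarrow> ('a, 'b) module \<Rightarrow> ('a, 'b set) module" where
  "mod_p p Y = quot_module Y ((\<lambda>y. [p] \<cdot>\<^bsub>Y\<^esub> y) ` carrier Y)"

definition mat_vec ::
    "nat \<Rightarrow> nat \<Rightarrow> (nat \<times> nat \<Rightarrow> nat \<Rightarrow> int) \<Rightarrow> (nat \<Rightarrow> nat \<Rightarrow> int) \<Rightarrow> nat \<Rightarrow> nat \<Rightarrow> int" where
  "mat_vec p n A v = (\<lambda>i\<in>{1..n}. \<Oplus>\<^bsub>Zp p\<^esub>j\<in>{1..n}. A (i, j) \<otimes>\<^bsub>Zp p\<^esub> v j)"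

definition cok ::
    "nat \<Rightarrow> nat \<Rightarrow> (nat \<times> nat \<Rightarrow> nat \<Rightarrow> int) \<Rightarrow> (nat \<Rightarrow> int, (nat \<Rightarrow> nat \<Rightarrow> int) set) module" where
  "cok p n A = quot_module (Zp_vec p n) (mat_vec p n A ` carrier (Zp_vec p n))"


section \<open>Haar-random matrices and Cohen--Lenstra convergence\<close>

text \<open>
  The law of the Haar-random matrix supported on \<open>(\<sigma> 1, \<dots>, \<sigma> n)\<close>; the random matrix itself is
  the identity on this space (see \<open>distr_haar_random_matrix\<close> for arbitrary sample spaces).
\<close>

definition haar_entry :: "nat \<Rightarrow> (nat \<Rightarrow> nat set) \<Rightarrow> nat \<times> nat \<Rightarrow> (nat \<Rightarrow> int) measure" where
  "haar_entry p \<sigma> = (\<lambda>(i, j). if i \<in> \<sigma> j then haar p else return (Zp_borel p) \<zero>\<^bsub>Zp p\<^esub>)"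

definition haar_matrix :: "nat \<Rightarrow> nat \<Rightarrow> (nat \<Rightarrow> nat set) \<Rightarrow> (nat \<times> nat \<Rightarrow> nat \<Rightarrow> int) measure" where
  "haar_matrix p n \<sigma> = PiM ({1..n} \<times> {1..n}) (haar_entry p \<sigma>)"

definition cl :: "nat \<Rightarrow> nat \<Rightarrow> real" where
  "cl p m = inverse (real p ^ (m\<^sup>2)) * (\<Prod>i=1..m. inverse ((1 - inverse (real p ^ i))\<^sup>2)) *
            (\<Prod>i. 1 - inverse (real p ^ Suc i))"

definition converges_CL ::
    "nat \<Rightarrow> nat \<Rightarrow> (nat \<Rightarrow> '\<omega> measure) \<Rightarrow> (nat \<Rightarrow> '\<omega> \<Rightarrow> (nat \<Rightarrow> int, 'b) module) \<Rightarrow> bool" where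
  "converges_CL p m M Y \<longleftrightarrow>
     (\<lambda>n. measure (M n) {\<omega> \<in> space (M n). module_isomorphic (Zp p) (mod_p p (Y n \<omega>)) (Fp_vec p m)})
       \<longlonglongrightarrow> cl p m"


section \<open>Existence and uniqueness of the Haar probability measure\<close>

instance int :: second_countable_topology
proof
  show "\<exists>B::int set set. countable B \<and> open = generate_topology B"
    by (intro exI[of _ "range lessThan \<union> range greaterThan"]) (auto simp: open_int_def)
qed

context
  fixes p :: nat
  assumes p: "p > 0"
begin

lemma ppos: "int p ^ k > 0"
  using p by simp

lemma Zp_add: "x \<oplus>\<^bsub>Zp p\<^esub> y = (\<lambda>k. (x k + y k) mod int p ^ k)"
  by (simp add: Zp_def)

lemma Zp_carrierD:
  assumes "x \<in> carrier (Zp p)"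
  shows "0 \<le> x k" "x k < int p ^ k" "x k mod int p ^ k = x k" "x (Suc k) mod int p ^ k = x k"
  using assms by (auto simp: Zp_def)

lemma Zp_carrierI:
  assumes "\<And>k. x k \<in> {0..<int p ^ k}" "\<And>k. x (Suc k) mod int p ^ k = x k"
  shows "x \<in> carrier (Zp p)"
  using assms by (auto simp: Zp_def)

lemma mod_Suc_power: "(a mod int p ^ Suc k) mod int p ^ k = a mod int p ^ k"
  by (rule mod_mod_cancel) simp

lemma Zp_mod_le:
  assumes "x \<in> carrier (Zp p)" "k \<le> l"
  shows "x l mod int p ^ k = x k"
  using assms(2)
proof (induction l rule: dec_induct)
  case base
  show ?case using Zp_carrierD[OF assms(1)] by simp
next
  case (step l)
  have "x (Suc l) mod int p ^ k = (x (Suc l) mod int p ^ l) mod int p ^ k"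
    using step by (simp add: le_imp_power_dvd mod_mod_cancel)
  then show ?case using step Zp_carrierD(4)[OF assms(1)] by simp
qed

lemma Zp_seqI:
  assumes "\<And>k. f (Suc k) mod int p ^ k = f k mod int p ^ k"
  shows "(\<lambda>k. f k mod int p ^ k) \<in> carrier (Zp p)"
  using ppos assms by (intro Zp_carrierI) (auto simp: mod_Suc_power simp del: power_Suc)

lemma Zp_add_closed:
  assumes "x \<in> carrier (Zp p)" "y \<in> carrier (Zp p)"
  shows "x \<oplus>\<^bsub>Zp p\<^esub> y \<in> carrier (Zp p)"
  unfolding Zp_add
proof (rule Zp_seqI)
  show "(x (Suc k) + y (Suc k)) mod int p ^ k = (x k + y k) mod int p ^ k" for k
    using Zp_carrierD(4)[OF assms(1)] Zp_carrierD(4)[OF assms(2)] by (metis mod_add_eq)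
qed

lemma Zp_mult_closed:
  assumes "x \<in> carrier (Zp p)" "y \<in> carrier (Zp p)"
  shows "x \<otimes>\<^bsub>Zp p\<^esub> y \<in> carrier (Zp p)"
proof -
  have "(\<lambda>k. (x k * y k) mod int p ^ k) \<in> carrier (Zp p)"
  proof (rule Zp_seqI)
    show "(x (Suc k) * y (Suc k)) mod int p ^ k = (x k * y k) mod int p ^ k" for k
      using Zp_carrierD(4)[OF assms(1)] Zp_carrierD(4)[OF assms(2)] by (metis mod_mult_eq)
  qed
  then show ?thesis by (simp add: Zp_def)
qed

lemma Zp_of_int: "(\<lambda>k. a mod int p ^ k) \<in> carrier (Zp p)"
  by (rule Zp_seqI) simp

lemma Zp_zero: "\<zero>\<^bsub>Zp p\<^esub> \<in> carrier (Zp p)"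
  using p by (auto simp: Zp_def)

lemma Zp_cring: "cring (Zp p)"
proof (rule cringI)
  have D: "x k mod int p ^ k = x k" if "x \<in> carrier (Zp p)" for x k
    using Zp_carrierD[OF that] by simp
  show "abelian_group (Zp p)"
  proof (rule abelian_groupI)
    fix x assume x: "x \<in> carrier (Zp p)"
    have "(\<lambda>k. (- x k) mod int p ^ k) \<oplus>\<^bsub>Zp p\<^esub> x = \<zero>\<^bsub>Zp p\<^esub>"
      by (auto simp: Zp_def fun_eq_iff mod_add_left_eq)
    moreover have "(\<lambda>k. (- x k) mod int p ^ k) \<in> carrier (Zp p)"
      by (rule Zp_seqI) (metis Zp_carrierD(4)[OF x] mod_minus_eq)
    ultimately show "\<exists>y\<in>carrier (Zp p). y \<oplus>\<^bsub>Zp p\<^esub> x = \<zero>\<^bsub>Zp p\<^esub>" by blast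
  next
    fix x assume "x \<in> carrier (Zp p)"
    then show "\<zero>\<^bsub>Zp p\<^esub> \<oplus>\<^bsub>Zp p\<^esub> x = x" using D by (auto simp: Zp_def)
  next
    fix x y z assume "x \<in> carrier (Zp p)" "y \<in> carrier (Zp p)" "z \<in> carrier (Zp p)"
    show "(x \<oplus>\<^bsub>Zp p\<^esub> y) \<oplus>\<^bsub>Zp p\<^esub> z = x \<oplus>\<^bsub>Zp p\<^esub> (y \<oplus>\<^bsub>Zp p\<^esub> z)"
      by (simp add: Zp_def mod_add_left_eq mod_add_right_eq add.assoc)
    show "x \<oplus>\<^bsub>Zp p\<^esub> y = y \<oplus>\<^bsub>Zp p\<^esub> x" by (simp add: Zp_def add.commute)
  qed (rule Zp_add_closed Zp_zero; assumption)+
  show "comm_monoid (Zp p)"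
  proof (rule comm_monoidI)
    show "\<one>\<^bsub>Zp p\<^esub> \<in> carrier (Zp p)" using Zp_of_int[of 1] by (simp add: Zp_def)
    fix x assume "x \<in> carrier (Zp p)"
    then show "\<one>\<^bsub>Zp p\<^esub> \<otimes>\<^bsub>Zp p\<^esub> x = x"
      using D[of x] by (simp add: Zp_def mod_mult_left_eq)
  next
    fix x y z assume "x \<in> carrier (Zp p)" "y \<in> carrier (Zp p)" "z \<in> carrier (Zp p)"
    show "(x \<otimes>\<^bsub>Zp p\<^esub> y) \<otimes>\<^bsub>Zp p\<^esub> z = x \<otimes>\<^bsub>Zp p\<^esub> (y \<otimes>\<^bsub>Zp p\<^esub> z)"
      by (simp add: Zp_def mod_mult_left_eq mod_mult_right_eq mult.assoc)
    show "x \<otimes>\<^bsub>Zp p\<^esub> y = y \<otimes>\<^bsub>Zp p\<^esub> x" by (simp add: Zp_def mult.commute)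
  qed (rule Zp_mult_closed)
  fix x y z assume "x \<in> carrier (Zp p)" "y \<in> carrier (Zp p)" "z \<in> carrier (Zp p)"
  show "(x \<oplus>\<^bsub>Zp p\<^esub> y) \<otimes>\<^bsub>Zp p\<^esub> z = x \<otimes>\<^bsub>Zp p\<^esub> z \<oplus>\<^bsub>Zp p\<^esub> y \<otimes>\<^bsub>Zp p\<^esub> z"
    by (simp add: Zp_def mod_mult_left_eq mod_add_eq distrib_right)
qed

definition Zp_ball :: "nat \<Rightarrow> int \<Rightarrow> (nat \<Rightarrow> int) set" where
  "Zp_ball k a = {x \<in> carrier (Zp p). x k = a}"

lemma space_Zp_borel: "space (Zp_borel p) = carrier (Zp p)"
  by (simp add: Zp_borel_def space_restrict_space)

lemma Zp_ball_sets: "Zp_ball k a \<in> sets (Zp_borel p)"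
proof -
  have "continuous_on UNIV (\<lambda>x :: nat \<Rightarrow> int. x k)"
    by (rule continuous_on_product_coordinates)
  then have "open ((\<lambda>x :: nat \<Rightarrow> int. x k) -` {a})"
    by (intro open_vimage discrete_topology_class.open_discrete)
  then have "(\<lambda>x :: nat \<Rightarrow> int. x k) -` {a} \<in> sets borel"
    by (rule borel_open)
  moreover have "Zp_ball k a = carrier (Zp p) \<inter> (\<lambda>x. x k) -` {a}"
    unfolding Zp_ball_def by blast
  ultimately show ?thesis
    unfolding Zp_borel_def sets_restrict_space by (rule rev_image_eqI)
qed

lemma measurable_Zp_borelI:
  assumes "\<And>x. x \<in> space N \<Longrightarrow> f x \<in> carrier (Zp p)"
    and "\<And>k a. {x \<in> space N. f x k = a} \<in> sets N"
  shows "f \<in> N \<rightarrow>\<^sub>M Zp_borel p"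
  unfolding Zp_borel_def
proof (rule measurable_restrict_space2)
  show "f \<in> space N \<rightarrow> carrier (Zp p)" using assms(1) by blast
  show "f \<in> N \<rightarrow>\<^sub>M borel"
  proof (rule measurable_coordinatewise_then_product)
    fix k
    have "(\<lambda>x. f x k) \<in> N \<rightarrow>\<^sub>M count_space UNIV"
    proof (subst measurable_count_space_eq2_countable, safe)
      show "(\<lambda>x. f x k) -` {a} \<inter> space N \<in> sets N" for a
      proof -
        have "(\<lambda>x. f x k) -` {a} \<inter> space N = {x \<in> space N. f x k = a}" by auto
        then show ?thesis using assms(2) by simp
      qed
    qed auto
    then show "(\<lambda>x. f x k) \<in> N \<rightarrow>\<^sub>M borel"
      using measurable_cong_sets[OF refl sets_borel_eq_count_space] by blast
  qed
qed

lemma sets_Zp_borel: 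
  "sets (Zp_borel p) = sigma_sets (carrier (Zp p)) {Zp_ball k a |k a. True}"
proof
  let ?G = "{Zp_ball k a |k a. True}"
  have G: "?G \<subseteq> Pow (carrier (Zp p))" by (auto simp: Zp_ball_def)
  show "sigma_sets (carrier (Zp p)) ?G \<subseteq> sets (Zp_borel p)"
    using Zp_ball_sets sets.sigma_sets_subset[of ?G "Zp_borel p"] by (auto simp: space_Zp_borel)
  have id: "(\<lambda>x. x) \<in> sigma (carrier (Zp p)) ?G \<rightarrow>\<^sub>M Zp_borel p"
  proof (rule measurable_Zp_borelI)
    fix k a
    have "{x \<in> space (sigma (carrier (Zp p)) ?G). x k = a} = Zp_ball k a"
      unfolding space_measure_of[OF G] by (simp add: Zp_ball_def)
    also have "\<dots> \<in> sets (sigma (carrier (Zp p)) ?G)"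
      unfolding sets_measure_of[OF G] by (rule sigma_sets.Basic) blast
    finally show "{x \<in> space (sigma (carrier (Zp p)) ?G). x k = a} \<in> sets (sigma (carrier (Zp p)) ?G)" .
  next
    fix x assume "x \<in> space (sigma (carrier (Zp p)) ?G)"
    then show "x \<in> carrier (Zp p)" unfolding space_measure_of[OF G] .
  qed
  have m: "A \<inter> space (sigma (carrier (Zp p)) ?G) \<in> sets (sigma (carrier (Zp p)) ?G)"
    if "A \<in> sets (Zp_borel p)" for A
    using measurable_sets[OF id that] by (simp only: vimage_ident)
  show "sets (Zp_borel p) \<subseteq> sigma_sets (carrier (Zp p)) ?G"
  proof
    fix A assume A: "A \<in> sets (Zp_borel p)"
    then have "A \<subseteq> carrier (Zp p)" using sets.sets_into_space space_Zp_borel by blast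
    then have "A \<inter> carrier (Zp p) = A" by blast
    with m[OF A] show "A \<in> sigma_sets (carrier (Zp p)) ?G"
      unfolding space_measure_of[OF G] sets_measure_of[OF G] by simp
  qed
qed

lemma Zp_ball_empty: "a \<notin> {0..<int p ^ k} \<Longrightarrow> Zp_ball k a = {}"
  using Zp_carrierD by (fastforce simp: Zp_ball_def)

lemma Zp_ball_Int: "\<exists>m c. Zp_ball k a \<inter> Zp_ball l b = Zp_ball m c"
proof -
  have *: "\<exists>m c. Zp_ball k a \<inter> Zp_ball l b = Zp_ball m c" if "k \<le> l" for k l a b
  proof (cases "b mod int p ^ k = a")
    case True
    have "x \<in> Zp_ball k a" if x: "x \<in> Zp_ball l b" for x
      using Zp_mod_le[of x k l] x True \<open>k \<le> l\<close> unfolding Zp_ball_def by simp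
    then have "Zp_ball k a \<inter> Zp_ball l b = Zp_ball l b" by blast
    then show ?thesis by blast
  next
    case False
    have "x \<notin> Zp_ball k a" if x: "x \<in> Zp_ball l b" for x
      using Zp_mod_le[of x k l] x False \<open>k \<le> l\<close> unfolding Zp_ball_def by simp
    then have "Zp_ball k a \<inter> Zp_ball l b = {}" by blast
    also have "{} = Zp_ball 0 (-1)" using Zp_ball_empty[of "-1" 0] by simp
    finally show ?thesis by blast
  qed
  show ?thesis
  proof (cases "k \<le> l")
    case False
    then show ?thesis using *[of l k b a] by (simp add: Int_commute)
  qed (rule *)
qed

lemma Zp_measure_eqI:
  assumes "prob_space M" "prob_space N"
    and "sets M = sets (Zp_borel p)" "sets N = sets (Zp_borel p)"
    and eq: "\<And>k a. a \<in> {0..<int p ^ k} \<Longrightarrow> emeasure M (Zp_ball k a) = emeasure N (Zp_ball k a)"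
  shows "M = N"
proof (rule measure_eqI_generator_eq[where A = "\<lambda>_. carrier (Zp p)" and \<Omega> = "carrier (Zp p)"
      and E = "{Zp_ball k a |k a. True}"])
  show "Int_stable {Zp_ball k a |k a. True}"
    unfolding Int_stable_def using Zp_ball_Int by blast
  show "{Zp_ball k a |k a. True} \<subseteq> Pow (carrier (Zp p))" by (auto simp: Zp_ball_def)
  show "emeasure M X = emeasure N X" if "X \<in> {Zp_ball k a |k a. True}" for X
  proof -
    from that obtain k a where X: "X = Zp_ball k a" by blast
    show ?thesis
    proof (cases "a \<in> {0..<int p ^ k}")
      case False
      then show ?thesis unfolding X Zp_ball_empty[OF False] by simp
    qed (simp only: X eq)
  qed
  have "carrier (Zp p) = Zp_ball 0 0"
    using Zp_carrierD[of _ 0] by (fastforce simp: Zp_ball_def)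
  then have "carrier (Zp p) \<in> {Zp_ball k a |k a. True}" by blast
  then show "range (\<lambda>_::nat. carrier (Zp p)) \<subseteq> {Zp_ball k a |k a. True}" by blast
  have "space M = carrier (Zp p)" 
    using sets_eq_imp_space_eq[OF assms(3)] space_Zp_borel by simp
  then show "emeasure M (carrier (Zp p)) \<noteq> \<infinity>"
    using prob_space.emeasure_space_1[OF assms(1)] by simp
  show "sets M = sigma_sets (carrier (Zp p)) {Zp_ball k a |k a. True}"
    unfolding assms(3) by (rule sets_Zp_borel)
  show "sets N = sigma_sets (carrier (Zp p)) {Zp_ball k a |k a. True}"
    unfolding assms(4) by (rule sets_Zp_borel)
qed simp

lemma measurable_Zp_translate:
  assumes "sets M = sets (Zp_borel p)" "a \<in> carrier (Zp p)"
  shows "(\<lambda>x. a \<oplus>\<^bsub>Zp p\<^esub> x) \<in> M \<rightarrow>\<^sub>M M"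
    and "b \<in> {0..<int p ^ k} \<Longrightarrow>
      (\<lambda>x. a \<oplus>\<^bsub>Zp p\<^esub> x) -` Zp_ball k b \<inter> space M = Zp_ball k ((b - a k) mod int p ^ k)"
proof -
  have sp: "space M = carrier (Zp p)" 
    using sets_eq_imp_space_eq[OF assms(1)] space_Zp_borel by simp
  have *: "(a k + x k) mod int p ^ k = b \<longleftrightarrow> x k = (b - a k) mod int p ^ k"
    if "x \<in> carrier (Zp p)" "b \<in> {0..<int p ^ k}" for x k b
  proof
    assume "(a k + x k) mod int p ^ k = b"
    then have "(b - a k) mod int p ^ k = (a k + x k - a k) mod int p ^ k"
      by (metis mod_diff_left_eq)
    then show "x k = (b - a k) mod int p ^ k" using Zp_carrierD[OF that(1)] by simp
  next
    assume "x k = (b - a k) mod int p ^ k"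
    then show "(a k + x k) mod int p ^ k = b" using that by (simp add: mod_add_right_eq)
  qed
  show ball: "(\<lambda>x. a \<oplus>\<^bsub>Zp p\<^esub> x) -` Zp_ball k b \<inter> space M = Zp_ball k ((b - a k) mod int p ^ k)"
    if "b \<in> {0..<int p ^ k}" for k b
    using that * Zp_add_closed[OF assms(2)] unfolding sp Zp_ball_def by (auto simp: Zp_add)
  have "(\<lambda>x. a \<oplus>\<^bsub>Zp p\<^esub> x) \<in> M \<rightarrow>\<^sub>M Zp_borel p"
  proof (rule measurable_Zp_borelI)
    fix k b
    have "{x \<in> space M. (a \<oplus>\<^bsub>Zp p\<^esub> x) k = b} = (\<lambda>x. a \<oplus>\<^bsub>Zp p\<^esub> x) -` Zp_ball k b \<inter> space M"
      using Zp_add_closed[OF assms(2)] unfolding sp Zp_ball_def by auto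
    also have "\<dots> \<in> sets M"
    proof (cases "b \<in> {0..<int p ^ k}")
      case True
      then show ?thesis using ball[OF True] Zp_ball_sets assms(1) by simp
    qed (simp add: Zp_ball_empty)
    finally show "{x \<in> space M. (a \<oplus>\<^bsub>Zp p\<^esub> x) k = b} \<in> sets M" .
  qed (use Zp_add_closed[OF assms(2)] in \<open>simp add: sp\<close>)
  then show "(\<lambda>x. a \<oplus>\<^bsub>Zp p\<^esub> x) \<in> M \<rightarrow>\<^sub>M M" using assms(1) measurable_cong_sets by blast
qed

lemma haar_prob_ball:
  assumes M: "is_haar_prob p M" and a: "a \<in> {0..<int p ^ k}"
  shows "emeasure M (Zp_ball k a) = ennreal (1 / real p ^ k)"
proof -
  interpret prob_space M using M by (simp add: is_haar_prob_def)
  have sM: "sets M = sets (Zp_borel p)" using M by (simp add: is_haar_prob_def)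
  have sp: "space M = carrier (Zp p)" 
    using sets_eq_imp_space_eq[OF sM] space_Zp_borel by simp
  have eq: "prob (Zp_ball k b) = prob (Zp_ball k 0)" if b: "b \<in> {0..<int p ^ k}" for b
  proof -
    let ?t = "\<lambda>i. b mod int p ^ i"
    have t: "?t \<in> carrier (Zp p)" by (rule Zp_of_int)
    have "distr M M (\<lambda>x. ?t \<oplus>\<^bsub>Zp p\<^esub> x) = M" using M t by (simp add: is_haar_prob_def)
    then have "prob (Zp_ball k b) = measure (distr M M (\<lambda>x. ?t \<oplus>\<^bsub>Zp p\<^esub> x)) (Zp_ball k b)" by simp
    also have "\<dots> = prob (Zp_ball k ((b - ?t k) mod int p ^ k))"
      using measurable_Zp_translate[OF sM t] b Zp_ball_sets sM
      by (subst measure_distr) auto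
    finally show ?thesis using b by simp
  qed
  have "carrier (Zp p) = (\<Union>b\<in>{0..<int p ^ k}. Zp_ball k b)"
    using Zp_carrierD by (auto simp: Zp_ball_def)
  then have "1 = prob (\<Union>b\<in>{0..<int p ^ k}. Zp_ball k b)" using prob_space sp by simp
  also have "\<dots> = (\<Sum>b\<in>{0..<int p ^ k}. prob (Zp_ball k b))"
    using Zp_ball_sets sM
    by (intro finite_measure_finite_Union) (auto simp: disjoint_family_on_def Zp_ball_def)
  also have "\<dots> = real p ^ k * prob (Zp_ball k 0)"
    by (simp add: eq nat_power_eq)
  finally have "prob (Zp_ball k 0) = 1 / real p ^ k" using p by (simp add: field_simps)
  then show ?thesis using eq[OF a] by (simp add: emeasure_eq_measure)
qed

lemma haar_prob_unique: "is_haar_prob p M \<Longrightarrow> is_haar_prob p N \<Longrightarrow> M = N"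
  by (rule Zp_measure_eqI) (auto simp: haar_prob_ball, auto simp: is_haar_prob_def)

text \<open>Existence: take independent uniform base \<open>p\<close> digits.\<close>

definition Zp_digits :: "(nat \<Rightarrow> int) \<Rightarrow> nat \<Rightarrow> int" where
  "Zp_digits d = (\<lambda>k. \<Sum>i<k. d i * int p ^ i)"

lemma Zp_digits_range:
  assumes "\<And>i. d i \<in> {0..<int p}"
  shows "Zp_digits d k \<in> {0..<int p ^ k}"
proof (induction k)
  case (Suc k)
  have "d k * int p ^ k \<le> (int p - 1) * int p ^ k"
    using assms[of k] by (intro mult_right_mono) auto
  then show ?case using Suc assms[of k] by (auto simp: Zp_digits_def algebra_simps)
qed (simp add: Zp_digits_def)

lemma Zp_digits_Suc_eq_iff:
  assumes "\<And>i. d i \<in> {0..<int p}"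
  shows "Zp_digits d (Suc k) = a \<longleftrightarrow> Zp_digits d k = a mod int p ^ k \<and> d k = a div int p ^ k"
proof -
  have S: "Zp_digits d (Suc k) = Zp_digits d k + d k * int p ^ k" by (simp add: Zp_digits_def)
  have *: "(Zp_digits d k + d k * int p ^ k) mod int p ^ k = Zp_digits d k"
          "(Zp_digits d k + d k * int p ^ k) div int p ^ k = d k"
    using Zp_digits_range[OF assms] p by auto
  show ?thesis
  proof
    assume "Zp_digits d (Suc k) = a"
    then show "Zp_digits d k = a mod int p ^ k \<and> d k = a div int p ^ k" using * S by auto
  next
    assume "Zp_digits d k = a mod int p ^ k \<and> d k = a div int p ^ k"
    then show "Zp_digits d (Suc k) = a" using S by (simp add: mod_div_mult_eq)
  qed
qed

lemma Zp_digits_carrier: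
  assumes "\<And>i. d i \<in> {0..<int p}"
  shows "Zp_digits d \<in> carrier (Zp p)"
proof (rule Zp_carrierI)
  show "Zp_digits d k \<in> {0..<int p ^ k}" for k by (rule Zp_digits_range[OF assms])
  show "Zp_digits d (Suc k) mod int p ^ k = Zp_digits d k" for k
    using Zp_digits_Suc_eq_iff[of d k "Zp_digits d (Suc k)"] assms by simp
qed

definition digit_space :: "(nat \<Rightarrow> int) measure" where
  "digit_space = PiM UNIV (\<lambda>_. uniform_count_measure {0..<int p})"

lemma digit_space_D: "d \<in> space digit_space \<Longrightarrow> d i \<in> {0..<int p}"
  by (auto simp: digit_space_def space_PiM space_uniform_count_measure)

lemma Zp_digits_eq:
  assumes "a \<in> {0..<int p ^ k}"
  shows "\<exists>e. (\<forall>i<k. e i \<in> {0..<int p}) \<and>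
    {d \<in> space digit_space. Zp_digits d k = a} = {d \<in> space digit_space. \<forall>i<k. d i = e i}"
  using assms
proof (induction k arbitrary: a)
  case 0
  then show ?case by (auto simp: Zp_digits_def)
next
  case (Suc k)
  have "a mod int p ^ k \<in> {0..<int p ^ k}" using ppos by simp
  from Suc.IH[OF this] obtain e where e: "\<forall>i<k. e i \<in> {0..<int p}"
    "{d \<in> space digit_space. Zp_digits d k = a mod int p ^ k}
      = {d \<in> space digit_space. \<forall>i<k. d i = e i}" by blast
  let ?e = "e(k := a div int p ^ k)"
  have "a div int p ^ k \<in> {0..<int p}"
  proof -
    have "a div int p ^ k * int p ^ k \<le> a"
      using ppos[of k] minus_mod_eq_div_mult[of a "int p ^ k"] pos_mod_sign[of "int p ^ k" a]
      by linarith
    also have "a < int p * int p ^ k" using Suc.prems by simp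
    finally have "a div int p ^ k < int p"
      using ppos[of k] by (simp add: mult_less_cancel_right)
    moreover have "0 \<le> a div int p ^ k"
      using Suc.prems ppos[of k] by (simp add: pos_imp_zdiv_nonneg_iff)
    ultimately show ?thesis by simp
  qed
  then have "\<forall>i<Suc k. ?e i \<in> {0..<int p}" using e by (auto simp: less_Suc_eq)
  moreover have "Zp_digits d (Suc k) = a \<longleftrightarrow> (\<forall>i<Suc k. d i = ?e i)"
    if d: "d \<in> space digit_space" for d
  proof -
    have "Zp_digits d (Suc k) = a \<longleftrightarrow> Zp_digits d k = a mod int p ^ k \<and> d k = a div int p ^ k"
      using digit_space_D[OF d] by (rule Zp_digits_Suc_eq_iff)
    also have "\<dots> \<longleftrightarrow> (\<forall>i<k. d i = e i) \<and> d k = a div int p ^ k" using e(2) d by blast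
    also have "\<dots> \<longleftrightarrow> (\<forall>i<Suc k. d i = ?e i)" by (auto simp: less_Suc_eq)
    finally show ?thesis .
  qed
  ultimately show ?case by blast
qed

lemma digit_ball:
  assumes "a \<in> {0..<int p ^ k}"
  shows "{d \<in> space digit_space. Zp_digits d k = a} \<in> sets digit_space"
    and "emeasure digit_space {d \<in> space digit_space. Zp_digits d k = a} = ennreal (1 / real p ^ k)"
proof -
  have ps: "prob_space (uniform_count_measure {0..<int p})"
    using p by (intro prob_space_uniform_count_measure) auto
  interpret U: prob_space "uniform_count_measure {0..<int p}" by (rule ps)
  interpret product_prob_space "\<lambda>_::nat. uniform_count_measure {0..<int p}" UNIV
    by unfold_locales
  obtain e where e: "\<forall>i<k. e i \<in> {0..<int p}" and eq:
    "{d \<in> space digit_space. Zp_digits d k = a} = {d \<in> space digit_space. \<forall>i<k. d i = e i}"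
    using Zp_digits_eq[OF assms] by blast
  have eq2: "{d \<in> space digit_space. Zp_digits d k = a}
      = {d \<in> space digit_space. \<forall>i\<in>{..<k}. d i \<in> {e i}}"
    unfolding eq by auto
  have s: "{e i} \<in> sets (uniform_count_measure {0..<int p})" if "i < k" for i
    using e that by (auto simp: sets_uniform_count_measure)
  show "{d \<in> space digit_space. Zp_digits d k = a} \<in> sets digit_space"
    unfolding eq2
  proof (rule sets.sets_Collect_finite_All)
    fix i assume "i \<in> {..<k}"
    then show "{d \<in> space digit_space. d i \<in> {e i}} \<in> sets digit_space"
      unfolding digit_space_def using s[of i] e
      by (intro sets_Collect_single) (auto simp: space_uniform_count_measure)
  qed simp
  have "emeasure digit_space {d \<in> space digit_space. Zp_digits d k = a}
      = (\<Prod>i<k. emeasure (uniform_count_measure {0..<int p}) {e i})"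
    unfolding eq2 unfolding digit_space_def using s by (intro emeasure_PiM_Collect) auto
  also have "\<dots> = (\<Prod>i<k. ennreal (1 / real p))"
    using e by (intro prod.cong) (auto simp: emeasure_uniform_count_measure)
  also have "\<dots> = ennreal (1 / real p ^ k)"
    by (simp add: ennreal_power power_one_over)
  finally show "emeasure digit_space {d \<in> space digit_space. Zp_digits d k = a}
    = ennreal (1 / real p ^ k)" .
qed

lemma haar_prob_exists: "\<exists>M. is_haar_prob p M"
proof -
  let ?M = "distr digit_space (Zp_borel p) Zp_digits"
  have ps: "prob_space (uniform_count_measure {0..<int p})"
    using p by (intro prob_space_uniform_count_measure) auto
  then have D: "prob_space digit_space" unfolding digit_space_def by (rule prob_space_PiM)
  have meas: "Zp_digits \<in> digit_space \<rightarrow>\<^sub>M Zp_borel p"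
  proof (rule measurable_Zp_borelI)
    fix k a
    show "{d \<in> space digit_space. Zp_digits d k = a} \<in> sets digit_space"
    proof (cases "a \<in> {0..<int p ^ k}")
      case False
      have "Zp_digits d k \<in> {0..<int p ^ k}" if "d \<in> space digit_space" for d
        using digit_space_D[OF that] by (rule Zp_digits_range)
      with False have "{d \<in> space digit_space. Zp_digits d k = a} = {}" by blast
      then show ?thesis by (simp only: sets.empty_sets)
    qed (rule digit_ball)
  qed (rule Zp_digits_carrier[OF digit_space_D])
  have M: "prob_space ?M" using D meas by (rule prob_space.prob_space_distr)
  have sM: "sets ?M = sets (Zp_borel p)" by simp
  have ball: "emeasure ?M (Zp_ball k a) = ennreal (1 / real p ^ k)"
    if "a \<in> {0..<int p ^ k}" for k a
  proof -
    have "emeasure ?M (Zp_ball k a) = emeasure digit_space (Zp_digits -` Zp_ball k a \<inter> space digit_space)"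
      using meas Zp_ball_sets by (rule emeasure_distr)
    also have "Zp_digits -` Zp_ball k a \<inter> space digit_space
        = {d \<in> space digit_space. Zp_digits d k = a}"
    proof -
      have "Zp_digits d \<in> carrier (Zp p)" if "d \<in> space digit_space" for d
        using digit_space_D[OF that] by (rule Zp_digits_carrier)
      then show ?thesis unfolding Zp_ball_def by blast
    qed
    finally show ?thesis using digit_ball(2)[OF that] by simp
  qed
  have "distr ?M ?M (\<lambda>x. a \<oplus>\<^bsub>Zp p\<^esub> x) = ?M" if a: "a \<in> carrier (Zp p)" for a
  proof (rule Zp_measure_eqI)
    note tr = measurable_Zp_translate[OF sM a]
    show "prob_space (distr ?M ?M (\<lambda>x. a \<oplus>\<^bsub>Zp p\<^esub> x))"
      using M tr(1) by (rule prob_space.prob_space_distr)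
    fix k b assume b: "b \<in> {0..<int p ^ k}"
    have "emeasure (distr ?M ?M (\<lambda>x. a \<oplus>\<^bsub>Zp p\<^esub> x)) (Zp_ball k b)
        = emeasure ?M ((\<lambda>x. a \<oplus>\<^bsub>Zp p\<^esub> x) -` Zp_ball k b \<inter> space ?M)"
      using Zp_ball_sets by (intro emeasure_distr[OF tr(1)]) simp
    also have "\<dots> = emeasure ?M (Zp_ball k b)"
      unfolding tr(2)[OF b] ball[OF b] using ppos[of k] by (intro ball) simp
    finally show "emeasure (distr ?M ?M (\<lambda>x. a \<oplus>\<^bsub>Zp p\<^esub> x)) (Zp_ball k b)
        = emeasure ?M (Zp_ball k b)" .
  qed (use M in simp_all)
  then have "is_haar_prob p ?M" unfolding is_haar_prob_def using M sM by blast
  then show ?thesis by blast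
qed

theorem is_haar_prob_haar: "is_haar_prob p (haar p)"
  unfolding haar_def using haar_prob_exists haar_prob_unique by (metis theI)

lemma prob_space_haar: "prob_space (haar p)"
  and sets_haar: "sets (haar p) = sets (Zp_borel p)"
  using is_haar_prob_haar by (simp_all add: is_haar_prob_def)

lemma prob_space_haar_entry: "prob_space (haar_entry p \<sigma> ij)"
  using prob_space_haar Zp_zero
  by (auto simp: haar_entry_def space_Zp_borel split: prod.split intro!: prob_space_return)

lemma sets_haar_entry: "sets (haar_entry p \<sigma> ij) = sets (Zp_borel p)"
  by (simp add: haar_entry_def sets_haar split: prod.split)

lemma prob_space_haar_matrix: "prob_space (haar_matrix p n \<sigma>)"
  unfolding haar_matrix_def by (rule prob_space_PiM) (rule prob_space_haar_entry)

end

text \<open>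
  Every random matrix with independent Haar-distributed entries on the support, and zeros
  elsewhere, has law \<^const>\<open>haar_matrix\<close>.
\<close>

theorem (in prob_space) distr_haar_random_matrix:
  fixes X :: "'a \<Rightarrow> nat \<times> nat \<Rightarrow> nat \<Rightarrow> int" and \<sigma> :: "nat \<Rightarrow> nat set" and n p :: nat
  assumes p: "p > 0"
    and indep: "indep_vars (\<lambda>_. Zp_borel p) (\<lambda>ij \<omega>. X \<omega> ij) {(i, j) \<in> {1..n} \<times> {1..n}. i \<in> \<sigma> j}"
    and haar: "\<And>i j. i \<in> {1..n} \<Longrightarrow> j \<in> {1..n} \<Longrightarrow> i \<in> \<sigma> j \<Longrightarrow>
                 distr M (Zp_borel p) (\<lambda>\<omega>. X \<omega> (i, j)) = haar p"
    and zero: "\<And>i j \<omega>. i \<in> {1..n} \<Longrightarrow> j \<in> {1..n} \<Longrightarrow> i \<notin> \<sigma> j \<Longrightarrow> \<omega> \<in> space M \<Longrightarrow>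
                 X \<omega> (i, j) = \<zero>\<^bsub>Zp p\<^esub>"
    and ext: "\<And>\<omega>. \<omega> \<in> space M \<Longrightarrow> X \<omega> \<in> extensional ({1..n} \<times> {1..n})"
  shows "distr M (haar_matrix p n \<sigma>) X = haar_matrix p n \<sigma>"
proof -
  define I where "I = {1..n} \<times> {1..n}"
  define J where "J = {(i, j) \<in> {1..n} \<times> {1..n}. i \<in> \<sigma> j}"
  have J: "J \<subseteq> I" "finite J" and I: "finite I"
    by (auto simp: I_def J_def intro: finite_subset[of _ "{1..n} \<times> {1..n}"])
  note indep = indep[folded J_def]
  have zero': "X \<omega> ij = \<zero>\<^bsub>Zp p\<^esub>" if "ij \<in> I - J" "\<omega> \<in> space M" for ij \<omega>
    using that zero by (auto simp: I_def J_def)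
  have rv: "(\<lambda>\<omega>. X \<omega> ij) \<in> M \<rightarrow>\<^sub>M Zp_borel p" if "ij \<in> I" for ij
  proof (cases "ij \<in> J")
    case True
    then show ?thesis using indep by (simp add: indep_vars_def)
  next
    case False
    then have "(\<lambda>\<omega>. X \<omega> ij) \<in> M \<rightarrow>\<^sub>M Zp_borel p \<longleftrightarrow> (\<lambda>\<omega>. \<zero>\<^bsub>Zp p\<^esub>) \<in> M \<rightarrow>\<^sub>M Zp_borel p"
      using that zero' by (intro measurable_cong) auto
    then show ?thesis using Zp_zero[OF p] space_Zp_borel[OF p] by simp
  qed
  have meas: "X \<in> M \<rightarrow>\<^sub>M haar_matrix p n \<sigma>"
    unfolding haar_matrix_def I_def[symmetric]
  proof (rule measurable_PiM_single')
    fix ij assume "ij \<in> I"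
    then show "(\<lambda>\<omega>. X \<omega> ij) \<in> M \<rightarrow>\<^sub>M haar_entry p \<sigma> ij"
      using rv measurable_cong_sets[OF refl sets_haar_entry[OF p]] by blast
  next
    show "X \<in> space M \<rightarrow> (\<Pi>\<^sub>E ij\<in>I. space (haar_entry p \<sigma> ij))"
      using rv[THEN measurable_space] ext sets_eq_imp_space_eq[OF sets_haar_entry[OF p]]
      by (auto simp: PiE_iff I_def)
  qed
  interpret P: product_sigma_finite "haar_entry p \<sigma>"
    by (rule product_sigma_finite.intro)
      (rule prob_space_imp_sigma_finite[OF prob_space_haar_entry[OF p]])
  show ?thesis
    unfolding haar_matrix_def I_def[symmetric]
  proof (rule P.PiM_eqI)
    fix A assume A: "\<And>ij. ij \<in> I \<Longrightarrow> A ij \<in> sets (haar_entry p \<sigma> ij)"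
    then have A': "A ij \<in> sets (Zp_borel p)" if "ij \<in> I" for ij
      using that sets_haar_entry[OF p] by metis
    have eJ: "emeasure (haar_entry p \<sigma> ij) (A ij) = prob ((\<lambda>\<omega>. X \<omega> ij) -` A ij \<inter> space M)"
      if ij: "ij \<in> J" for ij
    proof -
      have "haar_entry p \<sigma> ij = distr M (Zp_borel p) (\<lambda>\<omega>. X \<omega> ij)"
        using ij haar by (auto simp: haar_entry_def J_def)
      then show ?thesis
        using ij J rv[of ij] A'[of ij] by (auto simp: emeasure_distr emeasure_eq_measure)
    qed
    have e0: "emeasure (haar_entry p \<sigma> ij) (A ij) = indicator (A ij) \<zero>\<^bsub>Zp p\<^esub>"
      if "ij \<in> I - J" for ij
    proof -
      have "haar_entry p \<sigma> ij = return (Zp_borel p) \<zero>\<^bsub>Zp p\<^esub>"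
        using that by (auto simp: haar_entry_def I_def J_def split: if_splits)
      then show ?thesis using that A'[of ij] by simp
    qed
    have "emeasure (distr M (PiM I (haar_entry p \<sigma>)) X) (Pi\<^sub>E I A)
        = emeasure M (X -` Pi\<^sub>E I A \<inter> space M)"
      using meas A I unfolding haar_matrix_def I_def[symmetric]
      by (intro emeasure_distr sets_PiM_I_finite) auto
    also have "X -` Pi\<^sub>E I A \<inter> space M = {\<omega> \<in> space M. \<forall>ij\<in>I. X \<omega> ij \<in> A ij}"
      using ext by (auto simp: PiE_iff I_def)
    also have "emeasure M \<dots> = (\<Prod>ij\<in>I. emeasure (haar_entry p \<sigma> ij) (A ij))"
    proof (cases "\<forall>ij\<in>I - J. \<zero>\<^bsub>Zp p\<^esub> \<in> A ij")
      case True
      have "{\<omega> \<in> space M. \<forall>ij\<in>I. X \<omega> ij \<in> A ij} = {\<omega> \<in> space M. \<forall>ij\<in>J. X \<omega> ij \<in> A ij}"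
        using True zero' J by (auto 0 3)
      also have "emeasure M \<dots> = (\<Prod>ij\<in>J. emeasure (haar_entry p \<sigma> ij) (A ij))"
      proof (cases "J = {}")
        case False
        then have "{\<omega> \<in> space M. \<forall>ij\<in>J. X \<omega> ij \<in> A ij}
            = (\<Inter>ij\<in>J. (\<lambda>\<omega>. X \<omega> ij) -` A ij \<inter> space M)" by auto
        also have "prob \<dots> = (\<Prod>ij\<in>J. prob ((\<lambda>\<omega>. X \<omega> ij) -` A ij \<inter> space M))"
          using indep False J A' by (intro indep_varsD_finite) auto
        finally show ?thesis by (simp add: emeasure_eq_measure eJ prod_ennreal)
      qed (simp add: emeasure_space_1)
      also have "\<dots> = (\<Prod>ij\<in>I. emeasure (haar_entry p \<sigma> ij) (A ij))"
        using J I True e0 by (intro prod.mono_neutral_left) auto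
      finally show ?thesis .
    next
      case False
      then obtain ij where ij: "ij \<in> I - J" "\<zero>\<^bsub>Zp p\<^esub> \<notin> A ij" by blast
      then have "{\<omega> \<in> space M. \<forall>ij\<in>I. X \<omega> ij \<in> A ij} = {}" using zero' by fastforce
      moreover have "(\<Prod>ij\<in>I. emeasure (haar_entry p \<sigma> ij) (A ij)) = 0"
        using ij e0[OF ij(1)] I by (intro prod_zero) (auto intro!: bexI[of _ ij])
      ultimately show ?thesis by (simp only: emeasure_empty)
    qed
    finally show "emeasure (distr M (PiM I (haar_entry p \<sigma>)) X) (Pi\<^sub>E I A)
      = (\<Prod>ij\<in>I. emeasure (haar_entry p \<sigma> ij) (A ij))" .
  qed (simp_all add: I)
qed

end

theory Submission
  imports Defs
begin

text \<open>
  The module \<open>cok(X)/p cok(X)\<close> only sees the matrix modulo \<open>p\<close>: it is \<open>\<bbbF>\<^sub>p\<^sup>n\<close> modulo the span of the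
  reduced columns, so it is isomorphic to \<open>\<bbbF>\<^sub>p\<^sup>m\<close> exactly when that span has \<open>p\<^bsup>n-m\<^esup>\<close> elements
  (\<open>module_isomorphic_mod_p_cok_iff\<close>).

  Leave the last \<open>r\<close> columns empty. The corank is then at least \<open>r > 0\<close>, so corank \<open>0\<close> has
  probability \<open>0\<close>, whereas \<open>cl(0) > 0\<close>. This settles the negative half, and it leaves all the
  freedom in the first \<open>N = n - r\<close> columns: the corank is \<open>r\<close> exactly when these are linearly
  independent modulo \<open>p\<close>.

  For supports that are initial segments \<open>{1..s\<^sub>j}\<close> with \<open>s\<^sub>1 \<le> \<dots> \<le> s\<^sub>N\<close> this probability is an exact
  product. If the first \<open>j - 1\<close> columns are independent, their span has \<open>p\<^bsup>j-1\<^esup>\<close> elements, and all of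
  them lie among the \<open>p\<^bsup>s\<^sub>j\<^esup>\<close> equally likely values of column \<open>j\<close>. So column \<open>j\<close> is independent
  of its predecessors with probability \<open>x\<^sub>k = 1 - p\<^bsup>-k\<^esup>\<close> where \<open>k = s\<^sub>j - j + 1\<close>, and the
  probability of corank \<open>r\<close> is the product of these factors (\<open>prob_cok_rank_nested\<close>).

  Read the exponents \<open>k\<close> from the last column backwards. The conditions \<open>s\<^sub>j \<le> s\<^bsub>j+1\<^esub>\<close> and
  \<open>s\<^sub>N \<le> n\<close> say that they start at a value at most \<open>r + 1\<close> and increase by at most one at each
  step. In particular one infinite sequence \<open>r + 1 = e\<^sub>0, e\<^sub>1, \<dots>\<close> that stays or increases by
  one serves all \<open>n\<close> at once, and the probabilities of corank \<open>r\<close> are the partial products of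
  \<open>x\<^bsub>e\<^sub>i\<^esub>\<close>. Never repeating a value gives the limit \<open>\<Prod>\<^bsub>k>r\<^esub> x\<^sub>k\<close>; each repetition of \<open>k\<close> lowers
  it by the factor \<open>x\<^sub>k\<close>. Since \<open>x\<^sub>k\<close> tends to \<open>1\<close>, repeating greedily, as long as the limit does
  not fall below a target, reaches any target in \<open>(0, \<Prod>\<^bsub>k>r\<^esub> x\<^sub>k]\<close> (\<open>greedy_product\<close>).

  It remains to see that \<open>cl(r)\<close> is an admissible target (\<open>cl_bounds\<close>). It equals
  \<open>p\<^bsup>-r*r\<^esup> (\<Prod>\<^bsub>i\<le>r\<^esub> x\<^sub>i)\<^bsup>-1\<^esup> \<Prod>\<^bsub>k>r\<^esub> x\<^sub>k\<close>, and \<open>x\<^sub>i \<ge> p\<^bsup>-i\<^esup> \<ge> p\<^bsup>-r\<^esup>\<close> for \<open>1 \<le> i \<le> r\<close>.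
\<close>

section \<open>Linear algebra in an elementary abelian group\<close>

text \<open>
  A group of this kind is a vector space over \<open>\<bbbF>\<^sub>p\<close> with integers as scalars. It is
  stated for groups so that it covers both \<open>\<bbbF>\<^sub>p\<^sup>n\<close> and the quotient \<open>cok(A)/p cok(A)\<close>, whose carrier
  consists of sets of cosets, through their additive monoids.
\<close>

locale elementary_group = comm_group G for G (structure) +
  fixes p :: nat
  assumes prime_p: "prime p"
    and pow_p: "x \<in> carrier G \<Longrightarrow> x [^] p = \<one>"
begin

lemma int_pow_mod:
  assumes "x \<in> carrier G"
  shows "x [^] (a mod int p) = x [^] (a :: int)"
proof -
  have "x [^] a = x [^] (int p * (a div int p) + a mod int p)" by simp
  also have "\<dots> = (x [^] p) [^] (a div int p) \<otimes> x [^] (a mod int p)"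
    unfolding int_pow_int[of G x p, symmetric]
    using assms by (simp only: int_pow_mult[OF assms] int_pow_pow[OF assms])
  finally show ?thesis using assms by (simp add: pow_p)
qed

definition lincomb :: "nat \<Rightarrow> (nat \<Rightarrow> 'a) \<Rightarrow> (nat \<Rightarrow> int) \<Rightarrow> 'a" where
  "lincomb k c a = (\<Otimes>j\<in>{1..k}. c j [^] a j)"

text \<open>
  Coefficients are arbitrary integers rather than representatives modulo \<open>p\<close>, so that they can be
  added and scaled freely; hence divisibility by \<open>p\<close> takes the place of vanishing.
\<close>

definition independent :: "nat \<Rightarrow> (nat \<Rightarrow> 'a) \<Rightarrow> bool" where
  "independent k c \<longleftrightarrow> (\<forall>a. lincomb k c a = \<one> \<longrightarrow> (\<forall>j\<in>{1..k}. int p dvd a j))"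

definition span :: "nat \<Rightarrow> (nat \<Rightarrow> 'a) \<Rightarrow> 'a set" where
  "span k c = range (lincomb k c)"

abbreviation coeffs :: "nat \<Rightarrow> (nat \<Rightarrow> int) set" where
  "coeffs k \<equiv> {1..k} \<rightarrow>\<^sub>E {0..<int p}"

lemma card_coeffs: "card (coeffs k) = p ^ k"
  by (simp add: card_PiE)

lemma lincomb_closed [simp]: "c \<in> {1..k} \<rightarrow> carrier G \<Longrightarrow> lincomb k c a \<in> carrier G"
  unfolding lincomb_def by (intro finprod_closed) (auto simp: Pi_iff)

lemma lincomb_cong:
  assumes "c \<in> {1..k} \<rightarrow> carrier G" "\<And>j. j \<in> {1..k} \<Longrightarrow> c j = d j" "\<And>j. j \<in> {1..k} \<Longrightarrow> a j = b j"
  shows "lincomb k c a = lincomb k d b"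
  unfolding lincomb_def using assms by (intro finprod_cong') (auto simp: Pi_iff)

lemma lincomb_0: "lincomb 0 c a = \<one>"
  by (simp add: lincomb_def)

lemma lincomb_Suc:
  assumes "c \<in> {1..Suc k} \<rightarrow> carrier G"
  shows "lincomb (Suc k) c a = lincomb k c a \<otimes> c (Suc k) [^] a (Suc k)"
proof -
  have "lincomb (Suc k) c a = c (Suc k) [^] a (Suc k) \<otimes> lincomb k c a"
    unfolding lincomb_def atLeastAtMostSuc_conv[OF le_add1[of 1 k, unfolded plus_1_eq_Suc]]
    using assms by (subst finprod_insert) (auto simp: Pi_iff)
  moreover have "lincomb k c a \<in> carrier G" using assms by (auto simp: Pi_iff)
  ultimately show ?thesis using assms by (auto simp: Pi_iff m_comm)
qed

lemma lincomb_add: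
  assumes "c \<in> {1..k} \<rightarrow> carrier G"
  shows "lincomb k c (\<lambda>j. a j + b j) = lincomb k c a \<otimes> lincomb k c b"
  using assms
proof (induction k)
  case (Suc k)
  have c: "c \<in> {1..k} \<rightarrow> carrier G" "c (Suc k) \<in> carrier G" using Suc.prems by (auto simp: Pi_iff)
  moreover from this have "lincomb k c a \<in> carrier G" "lincomb k c b \<in> carrier G" by simp_all
  ultimately show ?case using Suc by (simp add: lincomb_Suc int_pow_mult m_ac)
qed (simp add: lincomb_0)

lemma lincomb_scale:
  assumes "c \<in> {1..k} \<rightarrow> carrier G"
  shows "lincomb k c (\<lambda>j. a j * u) = lincomb k c a [^] u"
  using assms
proof (induction k)
  case (Suc k)
  have c: "c \<in> {1..k} \<rightarrow> carrier G" "c (Suc k) \<in> carrier G" using Suc.prems by (auto simp: Pi_iff)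
  then show ?case using Suc by (simp add: lincomb_Suc int_pow_distrib int_pow_pow)
qed (simp add: lincomb_0)

lemma lincomb_mod:
  assumes "c \<in> {1..k} \<rightarrow> carrier G"
  shows "lincomb k c (\<lambda>j\<in>{1..k}. a j mod int p) = lincomb k c a"
  using assms unfolding lincomb_def by (intro finprod_cong') (auto simp: Pi_iff int_pow_mod)

lemma mod_in_coeffs: "(\<lambda>j\<in>{1..k}. a j mod int p) \<in> coeffs k"
  using prime_gt_0_nat[OF prime_p] by (auto simp: PiE_iff)

lemma span_conv_coeffs:
  assumes "c \<in> {1..k} \<rightarrow> carrier G"
  shows "span k c = lincomb k c ` coeffs k"
proof
  show "span k c \<subseteq> lincomb k c ` coeffs k"
    unfolding span_def using lincomb_mod[OF assms, symmetric] mod_in_coeffs by blast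
qed (auto simp: span_def)

lemma lincomb_minus:
  assumes "c \<in> {1..k} \<rightarrow> carrier G"
  shows "lincomb k c (\<lambda>j. - a j) = inv (lincomb k c a)"
  using lincomb_scale[OF assms, of a "-1"] lincomb_closed[OF assms] by (simp add: int_pow_neg)

lemma subgroup_span:
  assumes "c \<in> {1..k} \<rightarrow> carrier G"
  shows "subgroup (span k c) G"
proof (rule subgroupI)
  show "span k c \<subseteq> carrier G" using assms by (auto simp: span_def)
  show "span k c \<noteq> {}" by (auto simp: span_def)
  fix x y assume x: "x \<in> span k c" and y: "y \<in> span k c"
  from x y obtain a b where ab: "x = lincomb k c a" "y = lincomb k c b" by (auto simp: span_def)
  show "inv x \<in> span k c" unfolding span_def ab(1) lincomb_minus[OF assms, symmetric] by (rule rangeI)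
  show "x \<otimes> y \<in> span k c" unfolding span_def ab lincomb_add[OF assms, symmetric] by (rule rangeI)
qed

text \<open>
  The difference of two coefficient vectors with the same linear combination is a relation; the
  coefficients in \<open>{0..<p}\<close> represent each residue once.
\<close>

lemma independent_iff_inj_on:
  assumes c: "c \<in> {1..k} \<rightarrow> carrier G"
  shows "independent k c \<longleftrightarrow> inj_on (lincomb k c) (coeffs k)"
proof
  assume I: "independent k c"
  show "inj_on (lincomb k c) (coeffs k)"
  proof (rule inj_onI)
    fix a b assume ab: "a \<in> coeffs k" "b \<in> coeffs k" "lincomb k c a = lincomb k c b"
    have "lincomb k c (\<lambda>j. a j + - b j) = \<one>"
      unfolding lincomb_add[OF c] lincomb_minus[OF c] ab(3) by (rule r_inv[OF lincomb_closed[OF c]])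
    then have d: "int p dvd a j + - b j" if "j \<in> {1..k}" for j
      using I that unfolding independent_def by blast
    show "a = b"
    proof (rule PiE_ext[OF ab(1,2)])
      fix j assume j: "j \<in> {1..k}"
      then have "a j mod int p = b j mod int p" using d[OF j] by (simp add: mod_eq_dvd_iff)
      moreover have "a j \<in> {0..<int p}" "b j \<in> {0..<int p}" using ab j by (auto simp: PiE_iff)
      ultimately show "a j = b j" by simp
    qed
  qed
next
  assume I: "inj_on (lincomb k c) (coeffs k)"
  show "independent k c"
    unfolding independent_def
  proof (intro allI impI ballI)
    fix a j assume a: "lincomb k c a = \<one>" and j: "j \<in> {1..k}"
    have "lincomb k c (\<lambda>j\<in>{1..k}. a j mod int p) = lincomb k c (\<lambda>j\<in>{1..k}. 0 mod int p)"
      unfolding lincomb_mod[OF c] a by (simp add: lincomb_def)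
    then have "(\<lambda>j\<in>{1..k}. a j mod int p) = (\<lambda>j\<in>{1..k}. 0 mod int p)"
      by (intro inj_onD[OF I] mod_in_coeffs)
    then have "a j mod int p = 0" using j by (auto dest: fun_cong[of _ _ j])
    then show "int p dvd a j" by auto
  qed
qed

lemma independent_iff_card_span:
  assumes c: "c \<in> {1..k} \<rightarrow> carrier G"
  shows "independent k c \<longleftrightarrow> card (span k c) = p ^ k"
  unfolding independent_iff_inj_on[OF c] span_conv_coeffs[OF c] card_coeffs[symmetric]
  by (rule inj_on_iff_eq_card) (auto intro!: finite_PiE)

text \<open>
  A relation among \<open>k + 1\<close> elements either does not involve the last one modulo \<open>p\<close>, and then it is
  a relation among the first \<open>k\<close>, or its last coefficient is invertible modulo \<open>p\<close>, and then the
  last element is a combination of the others.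
\<close>

lemma independent_Suc:
  assumes c: "c \<in> {1..Suc k} \<rightarrow> carrier G"
  shows "independent (Suc k) c \<longleftrightarrow> independent k c \<and> c (Suc k) \<notin> span k c"
proof -
  have ck: "c \<in> {1..k} \<rightarrow> carrier G" and cS: "c (Suc k) \<in> carrier G"
    using c by (auto simp: Pi_iff)
  have upd: "lincomb k c (a(Suc k := b)) = lincomb k c a" for a b
    using ck by (intro lincomb_cong) auto
  show ?thesis
  proof (intro iffI conjI)
    assume I: "independent (Suc k) c"
    show "independent k c"
      unfolding independent_def
    proof (intro allI impI ballI)
      fix a j assume a: "lincomb k c a = \<one>" and j: "j \<in> {1..k}"
      have "lincomb (Suc k) c (a(Suc k := 0)) = \<one>"
        unfolding lincomb_Suc[OF c] upd using a by simp
      then have "int p dvd (a(Suc k := 0)) j"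
        using I j unfolding independent_def by (metis atLeastAtMost_iff le_SucI)
      then show "int p dvd a j" using j by simp
    qed
    show "c (Suc k) \<notin> span k c"
    proof
      assume "c (Suc k) \<in> span k c"
      then obtain a where a: "c (Suc k) = lincomb k c a" by (auto simp: span_def)
      have "lincomb (Suc k) c (a(Suc k := - 1)) = \<one>"
        unfolding lincomb_Suc[OF c] upd using a[symmetric] cS by (simp add: int_pow_neg)
      then have "int p dvd (a(Suc k := -1)) (Suc k)"
        using I unfolding independent_def by (auto simp del: fun_upd_apply)
      then show False using prime_p by (simp add: not_prime_unit)
    qed
  next
    assume I: "independent k c \<and> c (Suc k) \<notin> span k c"
    show "independent (Suc k) c"
      unfolding independent_def
    proof (intro allI impI)
      fix a assume a: "lincomb (Suc k) c a = \<one>"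
      have dvd: "int p dvd a (Suc k)"
      proof (rule ccontr)
        assume "\<not> int p dvd a (Suc k)"
        then have "coprime (a (Suc k)) (int p)"
          using prime_p by (simp add: prime_imp_coprime coprime_commute)
        then obtain u where u: "[a (Suc k) * u = 1] (mod int p)"
          using cong_solve_coprime_int by blast
        have "lincomb k c (\<lambda>j. a j * u) \<otimes> c (Suc k) [^] (a (Suc k) * u) = \<one>"
          using lincomb_scale[OF c, of a u] a by (simp add: lincomb_Suc[OF c])
        also have "c (Suc k) [^] (a (Suc k) * u) = c (Suc k)"
          using int_pow_mod[OF cS, of "a (Suc k) * u"] int_pow_mod[OF cS, of 1] u cS
          by (simp add: cong_def)
        finally have "c (Suc k) = inv (lincomb k c (\<lambda>j. a j * u))"
          using ck cS by (metis inv_equality inv_inv lincomb_closed)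
        then show False using I lincomb_minus[OF ck] unfolding span_def by (metis rangeI)
      qed
      then have "c (Suc k) [^] a (Suc k) = \<one>"
        using int_pow_mod[OF cS, of "a (Suc k)"] by simp
      then have "lincomb k c a = \<one>" using a ck by (simp add: lincomb_Suc[OF c])
      then show "\<forall>j\<in>{1..Suc k}. int p dvd a j"
        using I dvd unfolding independent_def by (auto simp: le_Suc_eq)
    qed
  qed
qed

lemma independent_cong:
  assumes "c \<in> {1..k} \<rightarrow> carrier G" "\<And>j. j \<in> {1..k} \<Longrightarrow> c j = d j"
  shows "independent k c = independent k d" "span k c = span k d"
proof -
  have "lincomb k c = lincomb k d" using assms by (intro ext lincomb_cong) auto
  then show "independent k c = independent k d" "span k c = span k d"
    by (simp_all add: independent_def span_def)
qed

lemma span_subset_subgroup: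
  assumes "subgroup H G" "c \<in> {1..k} \<rightarrow> H"
  shows "span k c \<subseteq> H"
proof -
  have "lincomb k c a \<in> H" for a
    using assms(2)
  proof (induction k)
    case 0
    then show ?case using subgroup.one_closed[OF assms(1)] by (simp add: lincomb_0)
  next
    case (Suc k)
    then have "c \<in> {1..Suc k} \<rightarrow> carrier G" using subgroup.mem_carrier[OF assms(1)] by (auto simp: Pi_iff)
    moreover have "c (Suc k) [^] a (Suc k) \<in> H"
      using Suc.prems assms(1) by (intro subgroup_int_pow_closed) auto
    ultimately show ?case
      using Suc subgroup.m_closed[OF assms(1)] by (auto simp: lincomb_Suc Pi_iff)
  qed
  then show ?thesis by (auto simp: span_def)
qed

text \<open>
  Choose the elements one at a time. The \<open>p\<^sup>k\<close> elements spanned by an independent tuple with entries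
  in \<open>H 1, \<dots>, H k\<close> all lie in \<open>H (k + 1)\<close> because the subgroups increase, so the number of admissible
  next elements does not depend on the tuple. Where the subtraction truncates, \<open>H j\<close> has no
  room for the span of \<open>j - 1\<close> independent elements; then an earlier factor is already \<open>0\<close>.
\<close>

lemma card_independent_tuples:
  assumes H: "\<And>j. subgroup (H j) G" "\<And>j. finite (H j)" "\<And>j. 1 \<le> j \<Longrightarrow> j < k \<Longrightarrow> H j \<subseteq> H (Suc j)"
  shows "card {c \<in> {1..k} \<rightarrow>\<^sub>E carrier G. (\<forall>j\<in>{1..k}. c j \<in> H j) \<and> independent k c}
       = (\<Prod>j=1..k. card (H j) - p ^ (j - 1))"
proof -
  define S where "S k = {c \<in> {1..k} \<rightarrow>\<^sub>E carrier G. (\<forall>j\<in>{1..k}. c j \<in> H j) \<and> independent k c}" for k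
  have HG: "H j \<subseteq> carrier G" for j using H(1) by (simp add: subgroup.subset)
  have "card (S l) = (\<Prod>j=1..l. card (H j) - p ^ (j - 1))" if "l \<le> k" for l
    using that
  proof (induction l)
    case 0
    have "S 0 = {\<lambda>_. undefined}" unfolding S_def by (auto simp: independent_def)
    then show ?case by simp
  next
    case (Suc l)
    let ?f = "\<lambda>(c, y). c(Suc l := y)"
    have fin: "finite (S l)"
    proof (rule finite_subset)
      show "S l \<subseteq> {1..l} \<rightarrow>\<^sub>E (\<Union>j\<in>{1..l}. H j)" unfolding S_def PiE_def by blast
      show "finite ({1..l} \<rightarrow>\<^sub>E (\<Union>j\<in>{1..l}. H j))" using H(2) by (intro finite_PiE) auto
    qed
    have mono: "H i \<subseteq> H j" if "1 \<le> i" "i \<le> j" "j \<le> Suc l" for i j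
      using that(2,1,3)
    proof (induction j rule: dec_induct)
      case (step j)
      then show ?case using H(3)[of j] Suc.prems by auto
    qed simp
    \<comment> \<open>An independent tuple is an independent shorter tuple and a last entry outside its span.\<close>
    have bij: "bij_betw ?f (SIGMA c:S l. H (Suc l) - span l c) (S (Suc l))"
    proof (rule bij_betw_byWitness[where f' = "\<lambda>c. (c(Suc l := undefined), c (Suc l))"])
      show "\<forall>z\<in>SIGMA c:S l. H (Suc l) - span l c. ((?f z)(Suc l := undefined), ?f z (Suc l)) = z"
        by (auto simp: S_def PiE_iff extensional_def fun_eq_iff)
      show "\<forall>c\<in>S (Suc l). ?f (c(Suc l := undefined), c (Suc l)) = c" by auto
      show "?f ` (SIGMA c:S l. H (Suc l) - span l c) \<subseteq> S (Suc l)"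
      proof clarify
        fix c y assume c: "c \<in> S l" and y: "y \<in> H (Suc l)" "y \<notin> span l c"
        let ?c = "c(Suc l := y)"
        have cG: "c \<in> {1..l} \<rightarrow> carrier G" using c by (auto simp: S_def)
        then have "?c \<in> {1..Suc l} \<rightarrow> carrier G" using HG y by (auto simp: Pi_iff)
        moreover have "independent l ?c = independent l c" "span l ?c = span l c"
          using independent_cong[OF cG, of ?c] by auto
        ultimately have "independent (Suc l) ?c" using c y by (simp add: independent_Suc S_def)
        then show "c(Suc l := y) \<in> S (Suc l)"
          using c y HG by (auto simp: S_def PiE_iff extensional_def)
      qed
      show "(\<lambda>c. (c(Suc l := undefined), c (Suc l))) ` S (Suc l) \<subseteq> (SIGMA c:S l. H (Suc l) - span l c)"
      proof (rule image_subsetI)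
        fix c assume c: "c \<in> S (Suc l)"
        let ?c = "c(Suc l := undefined)"
        have "c \<in> {1..l} \<rightarrow> carrier G" using c by (auto simp: S_def)
        then have "independent l ?c = independent l c" "span l ?c = span l c"
          using independent_cong[of c l ?c] by auto
        moreover have "independent l c" "c (Suc l) \<notin> span l c"
          using c independent_Suc[of c l] by (auto simp: S_def)
        ultimately show "(?c, c (Suc l)) \<in> (SIGMA c:S l. H (Suc l) - span l c)"
          using c by (auto simp: S_def PiE_iff extensional_def)
      qed
    qed
    have "card (S (Suc l)) = card (SIGMA c:S l. H (Suc l) - span l c)"
      using bij_betw_same_card[OF bij] by simp
    also have "\<dots> = (\<Sum>c\<in>S l. card (H (Suc l) - span l c))"
      using fin H(2) by (intro card_SigmaI) auto
    also have "\<dots> = (\<Sum>c\<in>S l. card (H (Suc l)) - p ^ l)"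
    proof (rule sum.cong)
      fix c assume c: "c \<in> S l"
      then have "c \<in> {1..l} \<rightarrow> H (Suc l)" using mono[of _ "Suc l"] by (fastforce simp: S_def)
      then have sub: "span l c \<subseteq> H (Suc l)" using H(1) by (intro span_subset_subgroup)
      moreover have "card (span l c) = p ^ l"
        using c independent_iff_card_span[of c l] by (auto simp: S_def)
      ultimately show "card (H (Suc l) - span l c) = card (H (Suc l)) - p ^ l"
        using H(2) by (simp add: card_Diff_subset finite_subset)
    qed simp
    also have "\<dots> = card (S l) * (card (H (Suc l)) - p ^ l)" by simp
    finally show ?case using Suc by simp
  qed
  then show ?thesis unfolding S_def by simp
qed

text \<open>
  An independent tuple of maximal length spans. The length is bounded since \<open>k \<le> p\<^sup>k\<close>, and \<open>p\<^sup>k\<close> is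
  the size of the span.
\<close>

lemma ex_independent_spanning:
  assumes "finite (carrier G)"
  obtains k c where "c \<in> {1..k} \<rightarrow> carrier G" "independent k c" "span k c = carrier G"
proof -
  define P where "P k \<longleftrightarrow> (\<exists>c \<in> {1..k} \<rightarrow> carrier G. independent k c)" for k
  have bound: "k \<le> card (carrier G)" if P: "P k" for k
  proof -
    obtain c where c: "c \<in> {1..k} \<rightarrow> carrier G" "independent k c" using P unfolding P_def by blast
    have "k \<le> p ^ k" using prime_gt_1_nat[OF prime_p] by (simp add: power_gt_expt less_imp_le)
    also have "p ^ k = card (span k c)" using c independent_iff_card_span by simp
    also have "\<dots> \<le> card (carrier G)"
      using assms c by (intro card_mono subgroup.subset[OF subgroup_span])
    finally show ?thesis .
  qed
  have "P 0" by (auto simp: P_def independent_def)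
  then obtain k where k: "P k" "\<And>l. P l \<Longrightarrow> l \<le> k"
    using bound GreatestI_nat[of P 0 "card (carrier G)"] Greatest_le_nat[of P _ "card (carrier G)"] by blast
  then obtain c where c: "c \<in> {1..k} \<rightarrow> carrier G" "independent k c" unfolding P_def by blast
  have "y \<in> span k c" if y: "y \<in> carrier G" for y
  proof (rule ccontr)
    assume n: "y \<notin> span k c"
    let ?c = "c(Suc k := y)"
    have "?c \<in> {1..Suc k} \<rightarrow> carrier G" using c y by (auto simp: Pi_iff)
    moreover have "independent k ?c = independent k c" "span k ?c = span k c"
      using independent_cong[OF c(1), of ?c] by auto
    ultimately have "P (Suc k)" unfolding P_def using c n independent_Suc[of ?c k] by auto
    then show False using k(2) by fastforce
  qed
  then have "span k c = carrier G" using subgroup.subset[OF subgroup_span[OF c(1)]] by blast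
  with c that show ?thesis by blast
qed

lemma lincomb_append_ones:
  assumes "N \<le> n" "c \<in> {1..n} \<rightarrow> carrier G" "\<And>j. N < j \<Longrightarrow> j \<le> n \<Longrightarrow> c j = \<one>"
  shows "lincomb n c a = lincomb N c a"
  using assms
proof (induction n rule: dec_induct)
  case (step n)
  have c: "c \<in> {1..n} \<rightarrow> carrier G" using step.prems by (auto simp: Pi_iff)
  then have "lincomb n c a = lincomb N c a" using step by simp
  moreover have "c (Suc n) = \<one>" using step by simp
  ultimately show ?case using lincomb_Suc[OF step.prems(1)] c step(1) by (simp add: Pi_iff)
qed simp

lemma inv_eq_pow:
  assumes "x \<in> carrier G"
  shows "inv x = x [^] (p - 1)"
proof (rule inv_equality)
  have "x [^] (p - 1) \<otimes> x = x [^] Suc (p - 1)" by simp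
  also have "Suc (p - 1) = p" using prime_gt_0_nat[OF prime_p] by simp
  finally show "x [^] (p - 1) \<otimes> x = \<one>" using assms by (simp add: pow_p)
qed (use assms in auto)

lemma card_span_le:
  assumes "c \<in> {1..k} \<rightarrow> carrier G"
  shows "card (span k c) \<le> p ^ k"
  unfolding span_conv_coeffs[OF assms] card_coeffs[symmetric]
  by (intro card_image_le finite_PiE) auto

end

section \<open>Quotients of modules\<close>

text \<open>
  Coordinates are numbered from 1 and reduction modulo \<open>p\<close> is evaluation at 1. Unfolding 1 into a
  successor would hide both from the rewrite rules stated with them.
\<close>

declare One_nat_def [simp del]

text \<open>
  The additive monoid of a quotient module is the factor group up to the extra record fields, so
  the two are different types and the group laws have to be carried over one by one.
\<close>

lemma comm_group_quot_module:
  assumes "comm_group (add_monoid M)" "subgroup N (add_monoid M)"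
  shows "comm_group (add_monoid (quot_module M N))"
proof -
  interpret Q: comm_group "add_monoid M Mod N"
    using assms by (rule comm_group.abelian_FactGroup)
  have eq: "carrier (add_monoid (quot_module M N)) = carrier (add_monoid M Mod N)"
    "monoid.mult (add_monoid (quot_module M N)) = monoid.mult (add_monoid M Mod N)"
    "one (add_monoid (quot_module M N)) = one (add_monoid M Mod N)"
    by (simp_all add: FactGroup_def quot_module_def A_RCOSETS_def set_add_def)
  show ?thesis
    by (rule comm_groupI; unfold eq)
      (fact Q.m_closed Q.one_closed Q.m_assoc Q.m_comm Q.l_one Q.l_inv_ex)+
qed

lemma coset_hom_quot_module:
  assumes "comm_group (add_monoid M)" "subgroup N (add_monoid M)"
  shows "(\<lambda>x. N +>\<^bsub>M\<^esub> x) \<in> hom (add_monoid M) (add_monoid (quot_module M N))"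
proof -
  have "normal N (add_monoid M)" using assms by (metis comm_group.axioms(2) comm_group.normal_iff_subgroup)
  from normal.r_coset_hom_Mod[OF this] show ?thesis
    by (simp add: hom_def FactGroup_def quot_module_def A_RCOSETS_def set_add_def a_r_coset_def)
qed

lemma carrier_quot_module: "carrier (quot_module M N) = (\<lambda>x. N +>\<^bsub>M\<^esub> x) ` carrier M"
  by (auto simp: quot_module_def A_RCOSETS_def RCOSETS_def a_r_coset_def)

lemma coset_eq_zero_iff:
  assumes "comm_group (add_monoid M)" "subgroup N (add_monoid M)" "x \<in> carrier M"
  shows "N +>\<^bsub>M\<^esub> x = N \<longleftrightarrow> x \<in> N"
proof -
  interpret comm_group "add_monoid M" by fact
  show ?thesis
    using coset_join1[of N x] coset_join2[of x N] subgroup.subset[OF assms(2)] assms(2,3)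
    by (auto simp: a_r_coset_def)
qed

text \<open>
  The action on a coset is defined as a union over its elements; it makes sense because all
  members of that union coincide.
\<close>

lemma smult_coset:
  assumes M: "comm_group (add_monoid M)" and N: "subgroup N (add_monoid M)"
    and a: "(\<lambda>x. a \<odot>\<^bsub>M\<^esub> x) \<in> hom (add_monoid M) (add_monoid M)"
    and aN: "\<And>x. x \<in> N \<Longrightarrow> a \<odot>\<^bsub>M\<^esub> x \<in> N" and x: "x \<in> carrier M"
  shows "a \<odot>\<^bsub>quot_module M N\<^esub> (N +>\<^bsub>M\<^esub> x) = N +>\<^bsub>M\<^esub> (a \<odot>\<^bsub>M\<^esub> x)"
proof -
  interpret comm_group "add_monoid M" by fact
  have xs: "x \<in> N +>\<^bsub>M\<^esub> x"
    using rcos_self[OF _ N, of x] x by (simp add: a_r_coset_def)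
  have "N +>\<^bsub>M\<^esub> (a \<odot>\<^bsub>M\<^esub> y) = N +>\<^bsub>M\<^esub> (a \<odot>\<^bsub>M\<^esub> x)" if y: "y \<in> N +>\<^bsub>M\<^esub> x" for y
  proof -
    obtain u where u: "u \<in> N" "y = u \<oplus>\<^bsub>M\<^esub> x" using y by (auto simp: a_r_coset_def r_coset_def)
    have uM: "u \<in> carrier M" using u subgroup.subset[OF N] by auto
    have ax: "a \<odot>\<^bsub>M\<^esub> x \<in> carrier M" using a x by (auto simp: hom_def)
    have "a \<odot>\<^bsub>M\<^esub> y = (a \<odot>\<^bsub>M\<^esub> u) \<oplus>\<^bsub>M\<^esub> (a \<odot>\<^bsub>M\<^esub> x)" using a uM x u(2) by (auto simp: hom_def)
    then have "a \<odot>\<^bsub>M\<^esub> y \<in> N +>\<^bsub>M\<^esub> (a \<odot>\<^bsub>M\<^esub> x)"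
      using aN[OF u(1)] by (auto simp: a_r_coset_def r_coset_def)
    from repr_independence[OF this[unfolded a_r_coset_def] _ N] ax show ?thesis
      by (simp add: a_r_coset_def)
  qed
  then have "(\<Union>y\<in>N +>\<^bsub>M\<^esub> x. N +>\<^bsub>M\<^esub> (a \<odot>\<^bsub>M\<^esub> y)) = N +>\<^bsub>M\<^esub> (a \<odot>\<^bsub>M\<^esub> x)"
    using xs by (intro SUP_eq_const) blast+
  then show ?thesis by (simp add: quot_module_def)
qed

text \<open>
  Together with the previous lemma this allows quotients to be iterated: the action on the
  cokernel again satisfies what is required for passing to the quotient by \<open>p\<close>.
\<close>

lemma smult_quot_module_hom:
  assumes M: "comm_group (add_monoid M)" and N: "subgroup N (add_monoid M)"
    and a: "(\<lambda>x. a \<odot>\<^bsub>M\<^esub> x) \<in> hom (add_monoid M) (add_monoid M)"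
    and aN: "\<And>x. x \<in> N \<Longrightarrow> a \<odot>\<^bsub>M\<^esub> x \<in> N"
  shows "(\<lambda>C. a \<odot>\<^bsub>quot_module M N\<^esub> C) \<in> hom (add_monoid (quot_module M N)) (add_monoid (quot_module M N))"
proof (rule homI)
  let ?Q = "quot_module M N"
  note h = coset_hom_quot_module[OF M N] and sm = smult_coset[OF M N a aN]
  have add: "(N +>\<^bsub>M\<^esub> x) \<oplus>\<^bsub>?Q\<^esub> (N +>\<^bsub>M\<^esub> y) = N +>\<^bsub>M\<^esub> (x \<oplus>\<^bsub>M\<^esub> y)"
    if "x \<in> carrier M" "y \<in> carrier M" for x y
    using hom_mult[OF h, of x y] that by simp
  have aM: "a \<odot>\<^bsub>M\<^esub> x \<in> carrier M" "a \<odot>\<^bsub>M\<^esub> (x \<oplus>\<^bsub>M\<^esub> y) = (a \<odot>\<^bsub>M\<^esub> x) \<oplus>\<^bsub>M\<^esub> (a \<odot>\<^bsub>M\<^esub> y)"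
    if "x \<in> carrier M" "y \<in> carrier M" for x y
    using a that by (auto simp: hom_def)
  have M_add: "x \<oplus>\<^bsub>M\<^esub> y \<in> carrier M" if "x \<in> carrier M" "y \<in> carrier M" for x y
    using monoid.m_closed[of "add_monoid M" x y] M that by (simp add: comm_group_def comm_monoid_def)
  fix C assume "C \<in> carrier (add_monoid ?Q)"
  then obtain x where x: "x \<in> carrier M" "C = N +>\<^bsub>M\<^esub> x" by (auto simp: carrier_quot_module)
  then show "a \<odot>\<^bsub>?Q\<^esub> C \<in> carrier (add_monoid ?Q)" using sm aM by (auto simp: carrier_quot_module)
  fix D assume "D \<in> carrier (add_monoid ?Q)"
  then obtain y where y: "y \<in> carrier M" "D = N +>\<^bsub>M\<^esub> y" by (auto simp: carrier_quot_module)
  show "a \<odot>\<^bsub>?Q\<^esub> (C \<otimes>\<^bsub>add_monoid ?Q\<^esub> D) = (a \<odot>\<^bsub>?Q\<^esub> C) \<otimes>\<^bsub>add_monoid ?Q\<^esub> (a \<odot>\<^bsub>?Q\<^esub> D)"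
    using x y aM by (simp add: add sm M_add)
qed

section \<open>Coordinate modules and reduction modulo p\<close>

lemma comm_group_coord_module:
  assumes "comm_group (add_monoid S)"
  shows "comm_group (add_monoid (coord_module \<phi> S n))"
proof -
  interpret S: comm_group "add_monoid S" by fact
  note S = S.m_closed[simplified] S.one_closed[simplified] S.m_assoc[simplified] S.m_comm[simplified]
    S.l_one[simplified] S.l_inv_ex[simplified]
  show ?thesis
  proof (rule comm_groupI)
    fix x assume x: "x \<in> carrier (add_monoid (coord_module \<phi> S n))"
    then have "\<forall>i\<in>{1..n}. \<exists>y\<in>carrier S. y \<oplus>\<^bsub>S\<^esub> x i = \<zero>\<^bsub>S\<^esub>"
      using S(6) by (fastforce simp: coord_module_def)
    then obtain y where "\<forall>i\<in>{1..n}. y i \<in> carrier S \<and> y i \<oplus>\<^bsub>S\<^esub> x i = \<zero>\<^bsub>S\<^esub>" by metis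
    then show "\<exists>y\<in>carrier (add_monoid (coord_module \<phi> S n)).
        y \<otimes>\<^bsub>add_monoid (coord_module \<phi> S n)\<^esub> x = \<one>\<^bsub>add_monoid (coord_module \<phi> S n)\<^esub>"
      by (intro bexI[of _ "restrict y {1..n}"]) (auto simp: coord_module_def fun_eq_iff)
    show "\<one>\<^bsub>add_monoid (coord_module \<phi> S n)\<^esub> \<otimes>\<^bsub>add_monoid (coord_module \<phi> S n)\<^esub> x = x"
      using x S.l_one by (auto simp: coord_module_def fun_eq_iff PiE_iff extensional_def)
  qed (use S in \<open>auto simp: coord_module_def fun_eq_iff PiE_iff\<close>)
qed

lemma coord_module_eval_hom:
  "i \<in> {1..n} \<Longrightarrow> (\<lambda>v. v i) \<in> hom (add_monoid (coord_module \<phi> S n)) (add_monoid S)"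
  by (auto simp: hom_def coord_module_def PiE_iff)

lemma coord_module_pow:
  assumes "comm_group (add_monoid S)" "v \<in> carrier (coord_module \<phi> S n)" "i \<in> {1..n}"
  shows "(v [^]\<^bsub>add_monoid (coord_module \<phi> S n)\<^esub> (q :: nat)) i = v i [^]\<^bsub>add_monoid S\<^esub> q"
proof (rule hom_nat_pow[where h = "\<lambda>v. v i"])
  show "group (add_monoid S)" "group (add_monoid (coord_module \<phi> S n))"
    using assms(1) comm_group_coord_module[OF assms(1)] by (blast intro: comm_group.axioms(2))+
qed (use assms coord_module_eval_hom in simp_all)

lemma carrier_Zp_vec: "carrier (Zp_vec p n) = {1..n} \<rightarrow>\<^sub>E carrier (Zp p)"
  by (simp add: coord_module_def)

lemma Fp_vec_zero: "i \<in> {1..n} \<Longrightarrow> \<zero>\<^bsub>Fp_vec p n\<^esub> i = 0"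
  by (simp add: coord_module_def residue_ring_def)

abbreviation "Fp_group p n \<equiv> add_monoid (Fp_vec p n)"

abbreviation "mat_image p n A \<equiv> mat_vec p n A ` carrier (Zp_vec p n)"

definition reduce :: "nat \<Rightarrow> (nat \<Rightarrow> nat \<Rightarrow> int) \<Rightarrow> nat \<Rightarrow> int" where
  "reduce n v = (\<lambda>i\<in>{1..n}. v i 1)"

definition column :: "nat \<Rightarrow> (nat \<times> nat \<Rightarrow> nat \<Rightarrow> int) \<Rightarrow> nat \<Rightarrow> nat \<Rightarrow> int" where
  "column n A j = reduce n (\<lambda>i. A (i, j))"

text \<open>
  The same column for a matrix that has already been reduced modulo \<open>p\<close>.
\<close>

definition matrix_column :: "nat \<Rightarrow> (nat \<times> nat \<Rightarrow> int) \<Rightarrow> nat \<Rightarrow> nat \<Rightarrow> int" where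
  "matrix_column n B j = (\<lambda>i\<in>{1..n}. B (i, j))"

definition supported_matrices :: "nat \<Rightarrow> nat \<Rightarrow> (nat \<Rightarrow> nat set) \<Rightarrow> (nat \<times> nat \<Rightarrow> int) set" where
  "supported_matrices p n \<sigma> = {B \<in> {1..n} \<times> {1..n} \<rightarrow>\<^sub>E {0..<int p}. \<forall>i\<in>{1..n}. \<forall>j\<in>{1..n}. i \<notin> \<sigma> j \<longrightarrow> B (i, j) = 0}"

context
  fixes p :: nat
  assumes prime_p: "prime p"
begin

lemma p_pos: "p > 0" using prime_p by (rule prime_gt_0_nat)

lemma comm_group_Zp: "comm_group (add_monoid (Zp p))"
proof -
  interpret cring "Zp p" using p_pos by (rule Zp_cring)
  show ?thesis by (rule a_comm_group)
qed

lemma comm_group_residue: "comm_group (add_monoid (residue_ring (int p)))"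
proof -
  interpret residues "int p" "residue_ring (int p)"
    using prime_gt_1_nat[OF prime_p] by unfold_locales auto
  show ?thesis by (rule a_comm_group)
qed

lemma Zp_pow:
  assumes "x \<in> carrier (Zp p)"
  shows "(x [^]\<^bsub>add_monoid (Zp p)\<^esub> (q :: nat)) k = (int q * x k) mod int p ^ k"
proof (induction q)
  case (Suc q)
  then show ?case
    by (simp add: Zp_add[OF p_pos] mod_simps algebra_simps)
qed (simp add: Zp_def)

lemma residue_pow:
  assumes "x \<in> {0..int p - 1}"
  shows "x [^]\<^bsub>add_monoid (residue_ring (int p))\<^esub> (q :: nat) = (int q * x) mod int p"
proof (induction q)
  case (Suc q)
  then show ?case
    by (simp add: residue_ring_def mod_simps algebra_simps)
qed (simp add: residue_ring_def)

lemma Zp_finsum: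
  assumes "finite J" "f \<in> J \<rightarrow> carrier (Zp p)"
  shows "finsum (Zp p) f J k = (\<Sum>j\<in>J. f j k) mod int p ^ k"
proof -
  interpret cring "Zp p" using p_pos by (rule Zp_cring)
  show ?thesis using assms
  proof (induction J rule: finite_induct)
    case empty
    have "\<zero>\<^bsub>Zp p\<^esub> k = 0" by (simp add: Zp_def)
    then show ?case by simp
  next
    case (insert j J)
    then show ?case by (simp add: Zp_add[OF p_pos] mod_add_right_eq Pi_iff)
  qed
qed

text \<open>
  The quotient \<open>(x - x 1) / p\<close> is computed componentwise. Dividing by \<open>p\<close> costs one digit of
  precision, so its \<open>k\<close>-th component comes from component \<open>k + 1\<close> of \<open>x\<close>.
\<close>

lemma Zp_decompose:
  assumes x: "x \<in> carrier (Zp p)"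
  obtains b where "b \<in> carrier (Zp p)" "\<And>k. x k = (x 1 + int p * b k) mod int p ^ k"
proof
  let ?f = "\<lambda>k. (x (Suc k) - x 1) div int p"
  have f: "int p * ?f k = x (Suc k) - x 1" for k
  proof -
    have "x (Suc k) mod int p ^ 1 = x 1" by (rule Zp_mod_le[OF p_pos x]) simp
    also have "\<dots> = x 1 mod int p ^ 1" using Zp_carrierD(3)[OF p_pos x, of 1] by simp
    finally have "int p dvd x (Suc k) - x 1" by (simp add: mod_eq_dvd_iff)
    then show ?thesis by simp
  qed
  show "(\<lambda>k. ?f k mod int p ^ k) \<in> carrier (Zp p)"
  proof (rule Zp_seqI[OF p_pos])
    fix k
    have "x (Suc (Suc k)) mod int p ^ Suc k = x (Suc k) mod int p ^ Suc k"
      unfolding Zp_carrierD(4)[OF p_pos x] Zp_carrierD(3)[OF p_pos x] ..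
    then have "int p ^ Suc k dvd (x (Suc (Suc k)) - x 1) - (x (Suc k) - x 1)"
      by (simp add: mod_eq_dvd_iff)
    then have "int p * int p ^ k dvd int p * (?f (Suc k) - ?f k)"
      unfolding right_diff_distrib f by simp
    then show "?f (Suc k) mod int p ^ k = ?f k mod int p ^ k"
      using p_pos by (simp add: mod_eq_dvd_iff)
  qed
  fix k
  have "(x 1 + int p * (?f k mod int p ^ k)) mod int p ^ k = (x 1 + int p * ?f k) mod int p ^ k"
    by (metis mod_add_right_eq mod_mult_right_eq)
  also have "\<dots> = x k" unfolding f using Zp_carrierD[OF p_pos x] by simp
  finally show "x k = (x 1 + int p * (?f k mod int p ^ k)) mod int p ^ k" by simp
qed

lemma Zp_vec_pow:
  assumes "v \<in> carrier (Zp_vec p n)" "i \<in> {1..n}"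
  shows "(v [^]\<^bsub>add_monoid (Zp_vec p n)\<^esub> (q :: nat)) i k = (int q * v i k) mod int p ^ k"
  unfolding coord_module_pow[OF comm_group_Zp assms]
  using assms by (intro Zp_pow) (auto simp: coord_module_def)

lemma Fp_vec_pow:
  assumes "v \<in> carrier (Fp_vec p n)" "i \<in> {1..n}"
  shows "(v [^]\<^bsub>add_monoid (Fp_vec p n)\<^esub> (q :: nat)) i = (int q * v i) mod int p"
  unfolding coord_module_pow[OF comm_group_residue assms]
  using assms by (intro residue_pow) (auto simp: coord_module_def residue_ring_def)

lemma carrier_Fp_vec: "carrier (Fp_vec p n) = {1..n} \<rightarrow>\<^sub>E {0..<int p}"
proof -
  have "{0..int p - 1} = {0..<int p}" by auto
  then show ?thesis by (simp add: coord_module_def residue_ring_def)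
qed

lemma elementary_group_Fp_vec: "elementary_group (Fp_group p n) p"
proof -
  interpret comm_group "Fp_group p n" using comm_group_residue by (rule comm_group_coord_module)
  show ?thesis
  proof
    fix x assume x: "x \<in> carrier (Fp_group p n)"
    show "x [^]\<^bsub>Fp_group p n\<^esub> p = \<one>\<^bsub>Fp_group p n\<^esub>"
    proof (rule PiE_ext)
      show "x [^]\<^bsub>Fp_group p n\<^esub> p \<in> {1..n} \<rightarrow>\<^sub>E {0..<int p}"
        using nat_pow_closed[OF x, of p] by (simp add: carrier_Fp_vec)
      show "\<one>\<^bsub>Fp_group p n\<^esub> \<in> {1..n} \<rightarrow>\<^sub>E {0..<int p}"
        using one_closed by (simp add: carrier_Fp_vec)
      fix i assume i: "i \<in> {1..n}"
      have "x \<in> carrier (Fp_vec p n)" using x by simp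
      from Fp_vec_pow[OF this i, of p] show "(x [^]\<^bsub>Fp_group p n\<^esub> p) i = \<one>\<^bsub>Fp_group p n\<^esub> i"
        using Fp_vec_zero[OF i] by simp
    qed
  qed (rule prime_p)
qed

lemma Fp_vec_lincomb:
  assumes c: "c \<in> {1..k} \<rightarrow> carrier (Fp_vec p n)" and a: "\<And>j. j \<in> {1..k} \<Longrightarrow> 0 \<le> a j"
    and i: "i \<in> {1..n}"
  shows "elementary_group.lincomb (Fp_group p n) k c a i = (\<Sum>j=1..k. a j * c j i) mod int p"
proof -
  interpret elementary_group "Fp_group p n" p by (rule elementary_group_Fp_vec)
  from c a show ?thesis
  proof (induction k)
    case 0
    then show ?case using i by (subst lincomb_0) (simp add: coord_module_def residue_ring_def)
  next
    case (Suc k)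
    let ?v = "c (Suc k) [^]\<^bsub>Fp_group p n\<^esub> a (Suc k)" and ?q = "nat (a (Suc k))"
    have ck: "c \<in> {1..k} \<rightarrow> carrier (Fp_vec p n)" and cS: "c (Suc k) \<in> carrier (Fp_vec p n)"
      using Suc.prems by (auto simp: Pi_iff)
    have "0 \<le> a (Suc k)" using Suc.prems(2)[of "Suc k"] by simp
    moreover from this have "?v = c (Suc k) [^]\<^bsub>Fp_group p n\<^esub> ?q" by simp
    ultimately have "?v i = (a (Suc k) * c (Suc k) i) mod int p"
      using Fp_vec_pow[OF cS i, of ?q] by (simp del: pow_nat)
    moreover have "lincomb k c a i = (\<Sum>j=1..k. a j * c j i) mod int p"
      using Suc.IH[OF ck] Suc.prems(2) by simp
    moreover have "(x \<otimes>\<^bsub>Fp_group p n\<^esub> y) i = (x i + y i) mod int p" for x y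
      using i by (simp add: coord_module_def residue_ring_def)
    ultimately show ?case
      using lincomb_Suc[of c k a] Suc.prems(1) by (simp add: mod_add_eq)
  qed
qed

lemma Zp_eval_1: "x \<in> carrier (Zp p) \<Longrightarrow> x 1 \<in> {0..<int p}"
  using Zp_carrierD(1,2)[OF p_pos, of x 1] by simp

lemma reduce_hom: "reduce n \<in> hom (add_monoid (Zp_vec p n)) (Fp_group p n)"
proof (rule homI)
  fix v assume "v \<in> carrier (add_monoid (Zp_vec p n))"
  then show "reduce n v \<in> carrier (Fp_group p n)"
    using Zp_eval_1 by (fastforce simp: carrier_Fp_vec carrier_Zp_vec reduce_def)
next
  fix v w
  show "reduce n (v \<otimes>\<^bsub>add_monoid (Zp_vec p n)\<^esub> w) = reduce n v \<otimes>\<^bsub>Fp_group p n\<^esub> reduce n w"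
    by (auto simp: reduce_def coord_module_def residue_ring_def Zp_add[OF p_pos])
qed

lemma reduce_image: "reduce n ` carrier (Zp_vec p n) = carrier (Fp_vec p n)"
proof
  show "reduce n ` carrier (Zp_vec p n) \<subseteq> carrier (Fp_vec p n)"
    using reduce_hom by (auto simp: hom_def)
  show "carrier (Fp_vec p n) \<subseteq> reduce n ` carrier (Zp_vec p n)"
  proof
    fix x assume x: "x \<in> carrier (Fp_vec p n)"
    let ?v = "\<lambda>i\<in>{1..n}. \<lambda>k. x i mod int p ^ k"
    have "reduce n ?v = x"
      using x by (auto simp: reduce_def carrier_Fp_vec PiE_iff extensional_def fun_eq_iff)
    moreover have "?v \<in> carrier (Zp_vec p n)"
      using Zp_of_int[OF p_pos] by (simp add: carrier_Zp_vec)
    ultimately show "x \<in> reduce n ` carrier (Zp_vec p n)" by (metis image_eqI)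
  qed
qed

lemma comm_group_Zp_vec: "comm_group (add_monoid (Zp_vec p n))"
  using comm_group_Zp by (rule comm_group_coord_module)

text \<open>
  A p-adic scalar acts like its residue modulo \<open>p\<close>, up to \<open>p\<close>-fold sums. So in a quotient killed
  by \<open>p\<close> the module structure is determined by the group structure.
\<close>

lemma Zp_vec_smult_decompose:
  assumes a: "a \<in> carrier (Zp p)" and v: "v \<in> carrier (Zp_vec p n)"
  obtains u where "u \<in> carrier (Zp_vec p n)"
    "a \<odot>\<^bsub>Zp_vec p n\<^esub> v = v [^]\<^bsub>add_monoid (Zp_vec p n)\<^esub> nat (a 1)
        \<oplus>\<^bsub>Zp_vec p n\<^esub> u [^]\<^bsub>add_monoid (Zp_vec p n)\<^esub> p"
proof -
  obtain b where b: "b \<in> carrier (Zp p)" "\<And>k. a k = (a 1 + int p * b k) mod int p ^ k"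
    using Zp_decompose[OF a] by blast
  interpret V: comm_group "add_monoid (Zp_vec p n)" by (rule comm_group_Zp_vec)
  define u where "u = b \<odot>\<^bsub>Zp_vec p n\<^esub> v"
  have closed: "x \<odot>\<^bsub>Zp_vec p n\<^esub> v \<in> carrier (Zp_vec p n)" if "x \<in> carrier (Zp p)" for x
    using that v Zp_mult_closed[OF p_pos] by (auto simp: coord_module_def)
  have u: "u \<in> carrier (Zp_vec p n)" unfolding u_def using b(1) by (rule closed)
  have a1: "int (nat (a 1)) = a 1" using Zp_eval_1[OF a] by simp
  have "a \<odot>\<^bsub>Zp_vec p n\<^esub> v = v [^]\<^bsub>add_monoid (Zp_vec p n)\<^esub> nat (a 1)
        \<oplus>\<^bsub>Zp_vec p n\<^esub> u [^]\<^bsub>add_monoid (Zp_vec p n)\<^esub> p" (is "_ = ?r")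
  proof (rule PiE_ext)
    show "a \<odot>\<^bsub>Zp_vec p n\<^esub> v \<in> {1..n} \<rightarrow>\<^sub>E carrier (Zp p)"
      using closed[OF a] by (simp add: carrier_Zp_vec)
    show "?r \<in> {1..n} \<rightarrow>\<^sub>E carrier (Zp p)"
      using V.m_closed[OF V.nat_pow_closed V.nat_pow_closed, of v u] u v by (simp add: carrier_Zp_vec)
    fix i assume i: "i \<in> {1..n}"
    have vi: "v i \<in> carrier (Zp p)" "u i \<in> carrier (Zp p)" using u v i by (auto simp: carrier_Zp_vec)
    have ui: "u i k = (b k * v i k) mod int p ^ k" for k
      using i by (simp add: u_def coord_module_def) (simp add: Zp_def)
    have add: "(x \<oplus>\<^bsub>Zp_vec p n\<^esub> y) i k = (x i k + y i k) mod int p ^ k" for x y k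
      using i by (simp add: coord_module_def) (simp add: Zp_add[OF p_pos])
    have "?r i k = (a 1 * v i k + int p * (b k * v i k)) mod int p ^ k" for k
      unfolding add Zp_vec_pow[OF v i] Zp_vec_pow[OF u i] a1 ui by (simp add: mod_simps)
    also have "\<dots> k = (((a 1 + int p * b k) mod int p ^ k) * v i k) mod int p ^ k" for k
      by (simp add: mod_simps algebra_simps)
    also have "\<dots> k = (a \<odot>\<^bsub>Zp_vec p n\<^esub> v) i k" for k
      unfolding b(2)[symmetric] using i by (simp add: coord_module_def) (simp add: Zp_def)
    finally show "(a \<odot>\<^bsub>Zp_vec p n\<^esub> v) i = ?r i" by (metis ext)
  qed
  with u that show ?thesis by blast
qed

text \<open>
  The kernel of the reduction consists of the \<open>p\<close>-fold sums, written here as \<open>p\<close>-th powers in the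
  additive monoid.
\<close>

lemma reduce_eq_zero_iff:
  assumes v: "v \<in> carrier (Zp_vec p n)"
  shows "reduce n v = \<zero>\<^bsub>Fp_vec p n\<^esub> \<longleftrightarrow>
     (\<exists>u\<in>carrier (Zp_vec p n). v = u [^]\<^bsub>add_monoid (Zp_vec p n)\<^esub> p)"
proof
  interpret V: comm_group "add_monoid (Zp_vec p n)" by (rule comm_group_Zp_vec)
  assume z: "reduce n v = \<zero>\<^bsub>Fp_vec p n\<^esub>"
  have "\<exists>b. \<forall>i\<in>{1..n}. b i \<in> carrier (Zp p) \<and> (\<forall>k. v i k = (int p * b i k) mod int p ^ k)"
  proof (rule bchoice, rule ballI)
    fix i assume i: "i \<in> {1..n}"
    then have vi: "v i \<in> carrier (Zp p)" using v by (auto simp: carrier_Zp_vec)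
    have "v i 1 = 0" using fun_cong[OF z, of i] i
      by (simp add: reduce_def coord_module_def residue_ring_def)
    then show "\<exists>b. b \<in> carrier (Zp p) \<and> (\<forall>k. v i k = (int p * b k) mod int p ^ k)"
      using Zp_decompose[OF vi] by (metis add_0)
  qed
  then obtain b where b: "\<forall>i\<in>{1..n}. b i \<in> carrier (Zp p) \<and> (\<forall>k. v i k = (int p * b i k) mod int p ^ k)" ..
  let ?u = "restrict b {1..n}"
  have u: "?u \<in> carrier (Zp_vec p n)" using b by (auto simp: carrier_Zp_vec)
  have "v = ?u [^]\<^bsub>add_monoid (Zp_vec p n)\<^esub> p"
  proof (rule PiE_ext)
    show "v \<in> {1..n} \<rightarrow>\<^sub>E carrier (Zp p)" using v by (simp add: carrier_Zp_vec)
    show "?u [^]\<^bsub>add_monoid (Zp_vec p n)\<^esub> p \<in> {1..n} \<rightarrow>\<^sub>E carrier (Zp p)"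
      using V.nat_pow_closed[of ?u p] u by (simp add: carrier_Zp_vec)
    fix i assume i: "i \<in> {1..n}"
    show "v i = (?u [^]\<^bsub>add_monoid (Zp_vec p n)\<^esub> p) i"
      using Zp_vec_pow[OF u i, of p] b i by (intro ext) simp
  qed
  with u show "\<exists>u\<in>carrier (Zp_vec p n). v = u [^]\<^bsub>add_monoid (Zp_vec p n)\<^esub> p" by blast
next
  interpret F: elementary_group "Fp_group p n" p by (rule elementary_group_Fp_vec)
  interpret V: comm_group "add_monoid (Zp_vec p n)" by (rule comm_group_Zp_vec)
  assume "\<exists>u\<in>carrier (Zp_vec p n). v = u [^]\<^bsub>add_monoid (Zp_vec p n)\<^esub> p"
  then obtain u where u: "u \<in> carrier (Zp_vec p n)" "v = u [^]\<^bsub>add_monoid (Zp_vec p n)\<^esub> p" by blast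
  have "reduce n v = reduce n u [^]\<^bsub>Fp_group p n\<^esub> p"
    unfolding u(2) using u(1) by (intro hom_nat_pow[OF reduce_hom]) (simp_all add: V.is_group F.is_group)
  also have "\<dots> = \<zero>\<^bsub>Fp_vec p n\<^esub>"
    using F.pow_p[of "reduce n u"] u(1) reduce_image by auto
  finally show "reduce n v = \<zero>\<^bsub>Fp_vec p n\<^esub>" .
qed

section \<open>The cokernel modulo p\<close>

lemma Zp_vec_add_eval:
  "i \<in> {1..n} \<Longrightarrow> (x \<oplus>\<^bsub>Zp_vec p n\<^esub> y) i k = (x i k + y i k) mod int p ^ k"
  by (simp add: coord_module_def) (simp add: Zp_add[OF p_pos])

lemma Zp_vec_smult_eval:
  "i \<in> {1..n} \<Longrightarrow> (a \<odot>\<^bsub>Zp_vec p n\<^esub> x) i k = (a k * x i k) mod int p ^ k"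
  by (simp add: coord_module_def) (simp add: Zp_def)

lemma Zp_vec_eqI:
  assumes "x \<in> carrier (Zp_vec p n)" "y \<in> carrier (Zp_vec p n)"
    and "\<And>i k. i \<in> {1..n} \<Longrightarrow> x i k = y i k"
  shows "x = y"
  using assms unfolding carrier_Zp_vec by (intro PiE_ext[of x "{1..n}" _ y] ext) auto

lemma Zp_vec_smult_closed:
  "a \<in> carrier (Zp p) \<Longrightarrow> v \<in> carrier (Zp_vec p n) \<Longrightarrow>
    a \<odot>\<^bsub>Zp_vec p n\<^esub> v \<in> carrier (Zp_vec p n)"
  by (auto simp: coord_module_def intro!: Zp_mult_closed[OF p_pos])

lemma Zp_vec_smult_hom:
  assumes a: "a \<in> carrier (Zp p)"
  shows "(\<lambda>v. a \<odot>\<^bsub>Zp_vec p n\<^esub> v) \<in> hom (add_monoid (Zp_vec p n)) (add_monoid (Zp_vec p n))"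
proof (rule homI; simp)
  interpret V: comm_group "add_monoid (Zp_vec p n)" by (rule comm_group_Zp_vec)
  fix v w assume v: "v \<in> carrier (Zp_vec p n)" and w: "w \<in> carrier (Zp_vec p n)"
  show "a \<odot>\<^bsub>Zp_vec p n\<^esub> v \<in> carrier (Zp_vec p n)" using a v by (rule Zp_vec_smult_closed)
  show "a \<odot>\<^bsub>Zp_vec p n\<^esub> (v \<oplus>\<^bsub>Zp_vec p n\<^esub> w)
      = a \<odot>\<^bsub>Zp_vec p n\<^esub> v \<oplus>\<^bsub>Zp_vec p n\<^esub> a \<odot>\<^bsub>Zp_vec p n\<^esub> w"
  proof (rule Zp_vec_eqI)
    show "a \<odot>\<^bsub>Zp_vec p n\<^esub> (v \<oplus>\<^bsub>Zp_vec p n\<^esub> w) \<in> carrier (Zp_vec p n)"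
      using V.m_closed[of v w] v w by (intro Zp_vec_smult_closed[OF a]) simp
    show "a \<odot>\<^bsub>Zp_vec p n\<^esub> v \<oplus>\<^bsub>Zp_vec p n\<^esub> a \<odot>\<^bsub>Zp_vec p n\<^esub> w \<in> carrier (Zp_vec p n)"
      using V.m_closed Zp_vec_smult_closed[OF a v] Zp_vec_smult_closed[OF a w] by simp
    fix i k assume i: "i \<in> {1..n}"
    show "(a \<odot>\<^bsub>Zp_vec p n\<^esub> (v \<oplus>\<^bsub>Zp_vec p n\<^esub> w)) i k
        = (a \<odot>\<^bsub>Zp_vec p n\<^esub> v \<oplus>\<^bsub>Zp_vec p n\<^esub> a \<odot>\<^bsub>Zp_vec p n\<^esub> w) i k"
      by (simp add: Zp_vec_smult_eval[OF i] Zp_vec_add_eval[OF i] mod_simps distrib_left)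
  qed
qed

lemma column_closed:
  assumes "A \<in> {1..n} \<times> {1..n} \<rightarrow> carrier (Zp p)" "j \<in> {1..n}"
  shows "column n A j \<in> carrier (Fp_vec p n)"
proof -
  have "A (i, j) 1 \<in> {0..<int p}" if "i \<in> {1..n}" for i
    using assms that by (intro Zp_eval_1) auto
  then show ?thesis by (auto simp: column_def reduce_def carrier_Fp_vec)
qed

context
  fixes n :: nat and A :: "nat \<times> nat \<Rightarrow> nat \<Rightarrow> int"
  assumes A: "A \<in> {1..n} \<times> {1..n} \<rightarrow> carrier (Zp p)"
begin

interpretation Zp: cring "Zp p" using p_pos by (rule Zp_cring)
interpretation V: comm_group "add_monoid (Zp_vec p n)" by (rule comm_group_Zp_vec)

lemma mat_vec_closed:
  assumes "v \<in> carrier (Zp_vec p n)"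
  shows "mat_vec p n A v \<in> carrier (Zp_vec p n)"
  using assms A unfolding mat_vec_def by (auto simp: carrier_Zp_vec Pi_iff PiE_iff intro!: Zp.finsum_closed)

lemma mat_vec_eval:
  assumes "v \<in> carrier (Zp_vec p n)" "i \<in> {1..n}"
  shows "mat_vec p n A v i k = (\<Sum>j=1..n. A (i, j) k * v j k) mod int p ^ k"
proof -
  have "mat_vec p n A v i k = finsum (Zp p) (\<lambda>j. A (i, j) \<otimes>\<^bsub>Zp p\<^esub> v j) {1..n} k"
    using assms by (simp add: mat_vec_def)
  also have "finsum (Zp p) (\<lambda>j. A (i, j) \<otimes>\<^bsub>Zp p\<^esub> v j) {1..n} k
      = (\<Sum>j=1..n. (A (i, j) \<otimes>\<^bsub>Zp p\<^esub> v j) k) mod int p ^ k"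
    using assms A by (intro Zp_finsum) (auto simp: carrier_Zp_vec Pi_iff PiE_iff)
  also have "\<dots> = (\<Sum>j=1..n. (A (i, j) k * v j k) mod int p ^ k) mod int p ^ k"
    by (simp add: Zp_def)
  finally show ?thesis by (simp add: mod_sum_eq)
qed

lemma mat_vec_hom: "mat_vec p n A \<in> hom (add_monoid (Zp_vec p n)) (add_monoid (Zp_vec p n))"
proof (rule homI; simp)
  fix v w assume v: "v \<in> carrier (Zp_vec p n)" and w: "w \<in> carrier (Zp_vec p n)"
  show "mat_vec p n A v \<in> carrier (Zp_vec p n)" using v by (rule mat_vec_closed)
  have vw: "v \<oplus>\<^bsub>Zp_vec p n\<^esub> w \<in> carrier (Zp_vec p n)" using V.m_closed v w by simp
  show "mat_vec p n A (v \<oplus>\<^bsub>Zp_vec p n\<^esub> w) = mat_vec p n A v \<oplus>\<^bsub>Zp_vec p n\<^esub> mat_vec p n A w"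
  proof (rule Zp_vec_eqI)
    show "mat_vec p n A (v \<oplus>\<^bsub>Zp_vec p n\<^esub> w) \<in> carrier (Zp_vec p n)" using vw by (rule mat_vec_closed)
    show "mat_vec p n A v \<oplus>\<^bsub>Zp_vec p n\<^esub> mat_vec p n A w \<in> carrier (Zp_vec p n)"
      using V.m_closed mat_vec_closed v w by simp
    fix i k assume i: "i \<in> {1..n}"
    have "mat_vec p n A (v \<oplus>\<^bsub>Zp_vec p n\<^esub> w) i k
        = (\<Sum>j=1..n. A (i, j) k * ((v j k + w j k) mod int p ^ k)) mod int p ^ k"
      unfolding mat_vec_eval[OF vw i] by (simp add: Zp_vec_add_eval)
    also have "\<dots> = (\<Sum>j=1..n. A (i, j) k * (v j k + w j k)) mod int p ^ k"
      by (subst (1 2) mod_sum_eq[symmetric]) (simp add: mod_simps)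
    also have "\<dots> = (mat_vec p n A v \<oplus>\<^bsub>Zp_vec p n\<^esub> mat_vec p n A w) i k"
      unfolding Zp_vec_add_eval[OF i] mat_vec_eval[OF v i] mat_vec_eval[OF w i]
      by (simp add: mod_simps distrib_left sum.distrib)
    finally show "mat_vec p n A (v \<oplus>\<^bsub>Zp_vec p n\<^esub> w) i k
      = (mat_vec p n A v \<oplus>\<^bsub>Zp_vec p n\<^esub> mat_vec p n A w) i k" .
  qed
qed

lemma mat_vec_smult:
  assumes a: "a \<in> carrier (Zp p)" and v: "v \<in> carrier (Zp_vec p n)"
  shows "a \<odot>\<^bsub>Zp_vec p n\<^esub> mat_vec p n A v = mat_vec p n A (a \<odot>\<^bsub>Zp_vec p n\<^esub> v)"
proof (rule Zp_vec_eqI)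
  note av = Zp_vec_smult_closed[OF a v]
  show "mat_vec p n A (a \<odot>\<^bsub>Zp_vec p n\<^esub> v) \<in> carrier (Zp_vec p n)" using av by (rule mat_vec_closed)
  show "a \<odot>\<^bsub>Zp_vec p n\<^esub> mat_vec p n A v \<in> carrier (Zp_vec p n)"
    using a mat_vec_closed[OF v] by (rule Zp_vec_smult_closed)
  fix i k assume i: "i \<in> {1..n}"
  have "mat_vec p n A (a \<odot>\<^bsub>Zp_vec p n\<^esub> v) i k
      = (\<Sum>j=1..n. A (i, j) k * ((a k * v j k) mod int p ^ k)) mod int p ^ k"
    unfolding mat_vec_eval[OF av i] by (simp add: Zp_vec_smult_eval)
  also have "\<dots> = (\<Sum>j=1..n. A (i, j) k * (a k * v j k)) mod int p ^ k"
    by (subst (1 2) mod_sum_eq[symmetric]) (simp add: mod_simps)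
  also have "\<dots> = (a k * (\<Sum>j=1..n. A (i, j) k * v j k)) mod int p ^ k"
    by (simp add: sum_distrib_left mult.left_commute)
  finally show "(a \<odot>\<^bsub>Zp_vec p n\<^esub> mat_vec p n A v) i k = mat_vec p n A (a \<odot>\<^bsub>Zp_vec p n\<^esub> v) i k"
    unfolding Zp_vec_smult_eval[OF i] mat_vec_eval[OF v i] by (simp add: mod_simps)
qed

lemma subgroup_mat_image: "subgroup (mat_image p n A) (add_monoid (Zp_vec p n))"
proof -
  interpret group_hom "add_monoid (Zp_vec p n)" "add_monoid (Zp_vec p n)" "mat_vec p n A"
    by unfold_locales (rule mat_vec_hom)
  show ?thesis using img_is_subgroup by simp
qed

text \<open>
  The product of a matrix with a vector is the combination of its columns whose coefficients are
  the coordinates of the vector, and every coefficient vector over \<open>\<bbbF>\<^sub>p\<close> lifts to \<open>\<int>\<^sub>p\<close>.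
\<close>

lemma reduce_mat_image: "reduce n ` mat_image p n A = elementary_group.span (Fp_group p n) n (column n A)"
proof -
  interpret F: elementary_group "Fp_group p n" p by (rule elementary_group_Fp_vec)
  have c: "column n A \<in> {1..n} \<rightarrow> carrier (Fp_group p n)" using column_closed[OF A] by simp
  have "reduce n (mat_vec p n A v) = F.lincomb n (column n A) (reduce n v)"
    if v: "v \<in> carrier (Zp_vec p n)" for v
  proof (rule PiE_ext)
    have rv: "reduce n v \<in> {1..n} \<rightarrow>\<^sub>E {0..<int p}"
      using reduce_image[of n] v by (auto simp: carrier_Fp_vec)
    show "reduce n (mat_vec p n A v) \<in> {1..n} \<rightarrow>\<^sub>E {0..<int p}"
      using reduce_image[of n] mat_vec_closed[OF v] by (auto simp: carrier_Fp_vec)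
    show "F.lincomb n (column n A) (reduce n v) \<in> {1..n} \<rightarrow>\<^sub>E {0..<int p}"
      using F.lincomb_closed[OF c] by (simp add: carrier_Fp_vec)
    fix i assume i: "i \<in> {1..n}"
    have "F.lincomb n (column n A) (reduce n v) i = (\<Sum>j=1..n. reduce n v j * column n A j i) mod int p"
      using c rv i by (intro Fp_vec_lincomb) (auto simp: PiE_iff)
    also have "\<dots> = reduce n (mat_vec p n A v) i"
      using mat_vec_eval[OF v i, of 1] i by (simp add: reduce_def column_def mult.commute)
    finally show "reduce n (mat_vec p n A v) i = F.lincomb n (column n A) (reduce n v) i" ..
  qed
  then have "reduce n ` mat_image p n A = F.lincomb n (column n A) ` reduce n ` carrier (Zp_vec p n)"
    by (simp add: image_image)
  also have "\<dots> = F.span n (column n A)"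
    unfolding F.span_conv_coeffs[OF c]
    using reduce_image[of n] by (simp only: carrier_Fp_vec)
  finally show ?thesis .
qed

text \<open>
  Let \<open>h\<close> be the projection of \<open>\<int>\<^sub>p\<^sup>n\<close> onto \<open>cok(A)/p cok(A)\<close>. Its kernel is the
  heart of the matter: \<open>h x\<close> vanishes exactly when the reduction of \<open>x\<close> lies in the span \<open>W\<close>
  of the reduced columns. Indeed \<open>h x\<close> vanishes iff \<open>x\<close> is the sum of an element of the image of \<open>A\<close>
  and a \<open>p\<close>-fold sum. Since the map from \<open>\<int>\<^sub>p\<^sup>n\<close> to \<open>\<bbbF>\<^sub>p\<^sup>n / W\<close> has the same kernel, the two quotients
  have the same size, and Lagrange's theorem counts the latter. The kernel also contains all
  \<open>p\<close>-fold sums, so the quotient has exponent \<open>p\<close> and p-adic scalars act through their residues.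
\<close>

lemma mod_p_cok:
  defines "Y \<equiv> mod_p p (cok p n A)"
  shows comm_group_mod_p_cok: "comm_group (add_monoid Y)"
    and pow_p_mod_p_cok: "\<And>y. y \<in> carrier Y \<Longrightarrow> y [^]\<^bsub>add_monoid Y\<^esub> p = \<one>\<^bsub>add_monoid Y\<^esub>"
    and smult_mod_p_cok: "\<And>a y. a \<in> carrier (Zp p) \<Longrightarrow> y \<in> carrier Y \<Longrightarrow>
          a \<odot>\<^bsub>Y\<^esub> y = y [^]\<^bsub>add_monoid Y\<^esub> nat (a 1)"
    and card_mod_p_cok: "card (carrier Y) * card (elementary_group.span (Fp_group p n) n (column n A)) = p ^ n"
proof -
  define M where "M = cok p n A"
  have M_eq: "M = quot_module (Zp_vec p n) (mat_image p n A)" unfolding M_def cok_def ..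
  interpret M: comm_group "add_monoid M"
    unfolding M_eq using V.comm_group_axioms subgroup_mat_image by (rule comm_group_quot_module)
  define P where "P = (\<lambda>y. [p] \<cdot>\<^bsub>M\<^esub> y) ` carrier M"
  have P_eq: "P = (\<lambda>y. y [^]\<^bsub>add_monoid M\<^esub> p) ` carrier M" unfolding P_def add_pow_def ..
  have Y_eq: "Y = quot_module M P" unfolding Y_def mod_p_def M_def P_def ..
  have P: "subgroup P (add_monoid M)"
  proof -
    interpret group_hom "add_monoid M" "add_monoid M" "\<lambda>y. y [^]\<^bsub>add_monoid M\<^esub> p"
      by unfold_locales (auto intro!: homI M.nat_pow_distrib M.nat_pow_closed[simplified])
    show ?thesis using img_is_subgroup by (simp add: P_eq)
  qed
  show Y: "comm_group (add_monoid Y)"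
    unfolding Y_eq using M.comm_group_axioms P by (rule comm_group_quot_module)
  interpret Y: comm_group "add_monoid Y" by (rule Y)
  define g where "g x = mat_image p n A +>\<^bsub>Zp_vec p n\<^esub> x" for x
  define h where "h x = P +>\<^bsub>M\<^esub> g x" for x
  have g: "g \<in> hom (add_monoid (Zp_vec p n)) (add_monoid M)"
    unfolding g_def M_eq using V.comm_group_axioms subgroup_mat_image by (rule coset_hom_quot_module)
  have h': "(\<lambda>C. P +>\<^bsub>M\<^esub> C) \<in> hom (add_monoid M) (add_monoid Y)"
    unfolding Y_eq using M.comm_group_axioms P by (rule coset_hom_quot_module)
  have h: "h \<in> hom (add_monoid (Zp_vec p n)) (add_monoid Y)"
    using hom_compose[OF g h'] by (simp add: h_def[abs_def] comp_def)
  have carrier_M: "carrier M = g ` carrier (Zp_vec p n)"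
    unfolding M_eq g_def by (rule carrier_quot_module)
  have carrier_Y: "carrier Y = h ` carrier (Zp_vec p n)"
    unfolding Y_eq carrier_quot_module carrier_M image_image h_def ..
  note g_pow = hom_nat_pow[OF g _ V.is_group M.is_group] and h_pow = hom_nat_pow[OF h _ V.is_group Y.is_group]
  interpret F: elementary_group "Fp_group p n" p by (rule elementary_group_Fp_vec)
  define W where "W = F.span n (column n A)"
  have c: "column n A \<in> {1..n} \<rightarrow> carrier (Fp_group p n)" using column_closed[OF A] by simp
  have W: "subgroup W (Fp_group p n)" unfolding W_def using c by (rule F.subgroup_span)
  \<comment> \<open>The kernel of the double projection, traced back through both quotients.\<close>
  have ker: "h x = \<one>\<^bsub>add_monoid Y\<^esub> \<longleftrightarrow> reduce n x \<in> W" if x: "x \<in> carrier (Zp_vec p n)" for x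
  proof -
    interpret g: group_hom "add_monoid (Zp_vec p n)" "add_monoid M" g
      by unfold_locales (rule g)
    interpret red: group_hom "add_monoid (Zp_vec p n)" "Fp_group p n" "reduce n"
      by unfold_locales (rule reduce_hom)
    have g1: "g w = \<one>\<^bsub>add_monoid M\<^esub> \<longleftrightarrow> w \<in> mat_image p n A" if "w \<in> carrier (Zp_vec p n)" for w
      using coset_eq_zero_iff[OF V.comm_group_axioms subgroup_mat_image that]
      by (simp add: g_def M_eq quot_module_def)
    have "h x = \<one>\<^bsub>add_monoid Y\<^esub> \<longleftrightarrow> g x \<in> P"
      using coset_eq_zero_iff[OF M.comm_group_axioms P, of "g x"] x carrier_M
      by (simp add: h_def Y_eq quot_module_def[of M])
    also have "\<dots> \<longleftrightarrow> (\<exists>u\<in>carrier (Zp_vec p n). g x = g u [^]\<^bsub>add_monoid M\<^esub> p)"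
      unfolding P_eq carrier_M by auto
    also have "\<dots> \<longleftrightarrow> (\<exists>u\<in>carrier (Zp_vec p n). x \<otimes>\<^bsub>add_monoid (Zp_vec p n)\<^esub> inv\<^bsub>add_monoid (Zp_vec p n)\<^esub> (u [^]\<^bsub>add_monoid (Zp_vec p n)\<^esub> p) \<in> mat_image p n A)"
      (is "_ \<longleftrightarrow> (\<exists>u\<in>_. ?d u \<in> mat_image p n A)")
    proof (rule bex_cong[OF refl])
      fix u assume u: "u \<in> carrier (Zp_vec p n)"
      let ?q = "u [^]\<^bsub>add_monoid (Zp_vec p n)\<^esub> p"
      have q: "?q \<in> carrier (add_monoid (Zp_vec p n))" using u by (intro V.nat_pow_closed) simp
      have x': "x \<in> carrier (add_monoid (Zp_vec p n))" using x by simp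
      have d: "?d u \<in> carrier (add_monoid (Zp_vec p n))" using x' q by (intro V.m_closed V.inv_closed)
      have "g x = g u [^]\<^bsub>add_monoid M\<^esub> p \<longleftrightarrow> g x = g ?q" using g_pow[of u p] u by simp
      also have "\<dots> \<longleftrightarrow> g x \<otimes>\<^bsub>add_monoid M\<^esub> inv\<^bsub>add_monoid M\<^esub> (g ?q) = \<one>\<^bsub>add_monoid M\<^esub>"
        using M.inv_solve_right'[OF M.one_closed g.hom_closed[OF x'] g.hom_closed[OF q]] g.hom_closed[OF q]
        by (metis M.l_one M.r_inv M.inv_closed M.m_assoc M.l_inv M.r_one g.hom_closed x')
      also have "\<dots> \<longleftrightarrow> g (?d u) = \<one>\<^bsub>add_monoid M\<^esub>"
        using x' q by (simp only: g.hom_mult g.hom_inv V.inv_closed)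
      also have "\<dots> \<longleftrightarrow> ?d u \<in> mat_image p n A" using d by (intro g1) simp
      finally show "g x = g u [^]\<^bsub>add_monoid M\<^esub> p \<longleftrightarrow> ?d u \<in> mat_image p n A" .
    qed
    also have "\<dots> \<longleftrightarrow> reduce n x \<in> reduce n ` mat_image p n A"
    proof
      assume "\<exists>u\<in>carrier (Zp_vec p n). ?d u \<in> mat_image p n A"
      then obtain u where u: "u \<in> carrier (Zp_vec p n)" "?d u \<in> mat_image p n A" by blast
      let ?q = "u [^]\<^bsub>add_monoid (Zp_vec p n)\<^esub> p"
      have q: "?q \<in> carrier (add_monoid (Zp_vec p n))" using u by (intro V.nat_pow_closed) simp
      have x': "x \<in> carrier (add_monoid (Zp_vec p n))" using x by simp
      have "reduce n ?q = \<one>\<^bsub>Fp_group p n\<^esub>" using reduce_eq_zero_iff[of ?q n] q u by auto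
      then have "reduce n (?d u) = reduce n x"
        using x' q by (simp only: red.hom_mult red.hom_inv V.inv_closed F.inv_one F.r_one red.hom_closed)
      then show "reduce n x \<in> reduce n ` mat_image p n A" using u(2) by (metis imageI)
    next
      assume "reduce n x \<in> reduce n ` mat_image p n A"
      then obtain w where w: "w \<in> mat_image p n A" "reduce n x = reduce n w" by blast
      have x': "x \<in> carrier (add_monoid (Zp_vec p n))" using x by simp
      have w': "w \<in> carrier (add_monoid (Zp_vec p n))" using w(1) mat_vec_closed by auto
      let ?e = "x \<otimes>\<^bsub>add_monoid (Zp_vec p n)\<^esub> inv\<^bsub>add_monoid (Zp_vec p n)\<^esub> w"
      have e: "?e \<in> carrier (add_monoid (Zp_vec p n))" using x' w' by (intro V.m_closed V.inv_closed)
      have "reduce n ?e = \<one>\<^bsub>Fp_group p n\<^esub>"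
        using x' w' w(2) by (simp only: red.hom_mult red.hom_inv V.inv_closed F.r_inv red.hom_closed)
      then obtain u where u: "u \<in> carrier (Zp_vec p n)" "?e = u [^]\<^bsub>add_monoid (Zp_vec p n)\<^esub> p"
        using reduce_eq_zero_iff[of ?e n] e by auto
      have "?d u = w" unfolding u(2)[symmetric]
        using x' w' by (metis V.inv_mult_group V.inv_inv V.inv_closed V.m_assoc V.m_comm V.r_inv V.r_one V.m_closed)
      then show "\<exists>u\<in>carrier (Zp_vec p n). ?d u \<in> mat_image p n A" using u(1) w(1) by metis
    qed
    finally show ?thesis unfolding W_def reduce_mat_image .
  qed
  show pow_p: "y [^]\<^bsub>add_monoid Y\<^esub> p = \<one>\<^bsub>add_monoid Y\<^esub>" if y: "y \<in> carrier Y" for y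
  proof -
    obtain u where u: "u \<in> carrier (Zp_vec p n)" "y = h u" using y carrier_Y by auto
    have q: "u [^]\<^bsub>add_monoid (Zp_vec p n)\<^esub> p \<in> carrier (add_monoid (Zp_vec p n))"
      using u by (intro V.nat_pow_closed) simp
    have "reduce n (u [^]\<^bsub>add_monoid (Zp_vec p n)\<^esub> p) = \<one>\<^bsub>Fp_group p n\<^esub>"
      using reduce_eq_zero_iff[of "u [^]\<^bsub>add_monoid (Zp_vec p n)\<^esub> p" n] q u by auto
    then have "reduce n (u [^]\<^bsub>add_monoid (Zp_vec p n)\<^esub> p) \<in> W" using subgroup.one_closed[OF W] by simp
    then show ?thesis using ker[of "u [^]\<^bsub>add_monoid (Zp_vec p n)\<^esub> p"] q h_pow[of u p] u by simp
  qed
  show "a \<odot>\<^bsub>Y\<^esub> y = y [^]\<^bsub>add_monoid Y\<^esub> nat (a 1)" if a: "a \<in> carrier (Zp p)" and y: "y \<in> carrier Y" for a y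
  proof -
    interpret h: group_hom "add_monoid (Zp_vec p n)" "add_monoid Y" h
      by unfold_locales (rule h)
    obtain v where v: "v \<in> carrier (Zp_vec p n)" "y = h v" using y carrier_Y by auto
    have aN: "a \<odot>\<^bsub>Zp_vec p n\<^esub> x \<in> mat_image p n A" if "x \<in> mat_image p n A" for x
      using that mat_vec_smult[OF a] Zp_vec_smult_closed[OF a] by auto
    have ag: "a \<odot>\<^bsub>M\<^esub> g x = g (a \<odot>\<^bsub>Zp_vec p n\<^esub> x)" if "x \<in> carrier (Zp_vec p n)" for x
      unfolding M_eq g_def using that
      by (intro smult_coset[OF V.comm_group_axioms subgroup_mat_image Zp_vec_smult_hom[OF a] aN])
    have aM: "(\<lambda>C. a \<odot>\<^bsub>M\<^esub> C) \<in> hom (add_monoid M) (add_monoid M)"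
      unfolding M_eq
      by (intro smult_quot_module_hom[OF V.comm_group_axioms subgroup_mat_image Zp_vec_smult_hom[OF a] aN])
    have aP: "a \<odot>\<^bsub>M\<^esub> C \<in> P" if C: "C \<in> P" for C
    proof -
      obtain D where D: "D \<in> carrier M" "C = D [^]\<^bsub>add_monoid M\<^esub> p" using C unfolding P_eq by blast
      have "a \<odot>\<^bsub>M\<^esub> C = (a \<odot>\<^bsub>M\<^esub> D) [^]\<^bsub>add_monoid M\<^esub> p"
        unfolding D(2) using D(1) by (intro hom_nat_pow[OF aM _ M.is_group M.is_group]) simp
      moreover have "a \<odot>\<^bsub>M\<^esub> D \<in> carrier M" using aM D(1) by (auto simp: hom_def)
      ultimately show ?thesis unfolding P_eq by blast
    qed
    have "a \<odot>\<^bsub>Y\<^esub> h v = P +>\<^bsub>M\<^esub> (a \<odot>\<^bsub>M\<^esub> g v)"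
      unfolding Y_eq h_def using carrier_M v
      by (intro smult_coset[OF M.comm_group_axioms P aM aP]) auto
    also have "\<dots> = h (a \<odot>\<^bsub>Zp_vec p n\<^esub> v)" unfolding h_def ag[OF v(1)] ..
    finally have 1: "a \<odot>\<^bsub>Y\<^esub> h v = h (a \<odot>\<^bsub>Zp_vec p n\<^esub> v)" .
    obtain u where u: "u \<in> carrier (Zp_vec p n)"
      "a \<odot>\<^bsub>Zp_vec p n\<^esub> v = v [^]\<^bsub>add_monoid (Zp_vec p n)\<^esub> nat (a 1)
          \<oplus>\<^bsub>Zp_vec p n\<^esub> u [^]\<^bsub>add_monoid (Zp_vec p n)\<^esub> p"
      using Zp_vec_smult_decompose[OF a v(1)] by blast
    have v': "v \<in> carrier (add_monoid (Zp_vec p n))" and u': "u \<in> carrier (add_monoid (Zp_vec p n))"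
      using u v by simp_all
    have "h (a \<odot>\<^bsub>Zp_vec p n\<^esub> v) = h (v [^]\<^bsub>add_monoid (Zp_vec p n)\<^esub> nat (a 1)
        \<otimes>\<^bsub>add_monoid (Zp_vec p n)\<^esub> u [^]\<^bsub>add_monoid (Zp_vec p n)\<^esub> p)" using u(2) by simp
    also have "\<dots> = h v [^]\<^bsub>add_monoid Y\<^esub> nat (a 1) \<otimes>\<^bsub>add_monoid Y\<^esub> h u [^]\<^bsub>add_monoid Y\<^esub> p"
      by (simp only: h.hom_mult[OF V.nat_pow_closed[OF v'] V.nat_pow_closed[OF u']] h_pow[OF v'] h_pow[OF u'])
    also have "h u [^]\<^bsub>add_monoid Y\<^esub> p = \<one>\<^bsub>add_monoid Y\<^esub>"
      using h.hom_closed[OF u'] by (intro pow_p) simp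
    also have "h v [^]\<^bsub>add_monoid Y\<^esub> nat (a 1) \<otimes>\<^bsub>add_monoid Y\<^esub> \<one>\<^bsub>add_monoid Y\<^esub> = h v [^]\<^bsub>add_monoid Y\<^esub> nat (a 1)"
      by (intro Y.r_one Y.nat_pow_closed h.hom_closed v')
    finally show ?thesis unfolding v(2) 1 .
  qed
  show "card (carrier Y) * card (elementary_group.span (Fp_group p n) n (column n A)) = p ^ n"
  proof -
    \<comment> \<open>The competing projection, onto \<open>\<bbbF>\<^sub>p\<^sup>n / W\<close>; the first isomorphism theorem compares it with \<open>h\<close>.\<close>
    define k where "k x = W #>\<^bsub>Fp_group p n\<^esub> reduce n x" for x
    have nW: "W \<lhd> Fp_group p n" using W by (simp add: F.normal_iff_subgroup)
    interpret FW: group "Fp_group p n Mod W" using nW by (rule normal.factorgroup_is_group)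
    have k: "k \<in> hom (add_monoid (Zp_vec p n)) (Fp_group p n Mod W)"
      using hom_compose[OF reduce_hom normal.r_coset_hom_Mod[OF nW]]
      by (simp add: k_def[abs_def] comp_def)
    interpret h: group_hom "add_monoid (Zp_vec p n)" "add_monoid Y" h
      by unfold_locales (rule h)
    interpret k: group_hom "add_monoid (Zp_vec p n)" "Fp_group p n Mod W" k
      by unfold_locales (rule k)
    have k1: "k x = \<one>\<^bsub>Fp_group p n Mod W\<^esub> \<longleftrightarrow> reduce n x \<in> W" if "x \<in> carrier (Zp_vec p n)" for x
    proof -
      have "reduce n x \<in> carrier (Fp_group p n)" using that reduce_image[of n] by auto
      then show ?thesis
        using F.coset_join1[OF _ _ W, of "reduce n x"] F.coset_join2[OF _ W, of "reduce n x"]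
        by (auto simp: k_def FactGroup_def)
    qed
    have ker_eq: "kernel (add_monoid (Zp_vec p n)) (add_monoid Y) h
        = kernel (add_monoid (Zp_vec p n)) (Fp_group p n Mod W) k"
      using ker k1 by (auto simp: kernel_def)
    have "k ` carrier (Zp_vec p n) = (\<lambda>x. W #>\<^bsub>Fp_group p n\<^esub> x) ` reduce n ` carrier (Zp_vec p n)"
      by (auto simp: k_def)
    also have "\<dots> = carrier (Fp_group p n Mod W)"
      unfolding reduce_image by (auto simp: FactGroup_def RCOSETS_def)
    finally have k_surj: "k ` carrier (add_monoid (Zp_vec p n)) = carrier (Fp_group p n Mod W)" by simp
    have "card (carrier Y) = card (carrier (Fp_group p n Mod W))"
      using h.FactGroup_iso_set k.FactGroup_iso_set[OF k_surj] carrier_Y unfolding ker_eq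
      by (auto simp: iso_def dest!: bij_betw_same_card)
    then have "card (carrier Y) * card W = order (Fp_group p n)"
      using F.lagrange[OF W] by (simp add: FactGroup_def)
    also have "\<dots> = p ^ n" by (simp add: order_def carrier_Fp_vec card_PiE)
    finally show ?thesis unfolding W_def .
  qed
qed

text \<open>
  The size of \<open>cok(A)/p cok(A)\<close> decides its isomorphism class: it is an elementary abelian group, so
  the linear combinations of a basis identify it with some \<open>\<bbbF>\<^sub>p\<^sup>k\<close>, and this identification respects
  p-adic scalars because on both sides they act through their residues.
\<close>

theorem module_isomorphic_mod_p_cok_iff:
  "module_isomorphic (Zp p) (mod_p p (cok p n A)) (Fp_vec p m) \<longleftrightarrow>
     card (elementary_group.span (Fp_group p n) n (column n A)) * p ^ m = p ^ n"
proof -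
  define Y where "Y = mod_p p (cok p n A)"
  define s where "s = card (elementary_group.span (Fp_group p n) n (column n A))"
  have card_Y: "card (carrier Y) * s = p ^ n" unfolding Y_def s_def by (rule card_mod_p_cok)
  then have s_pos: "s > 0" and Y_pos: "card (carrier Y) > 0"
    using p_pos by (metis gr0I mult_is_0 power_not_zero less_irrefl)+
  interpret Y: elementary_group "add_monoid Y" p
    by (intro elementary_group.intro elementary_group_axioms.intro)
      (use comm_group_mod_p_cok pow_p_mod_p_cok prime_p in \<open>simp_all add: Y_def\<close>)
  have smult: "a \<odot>\<^bsub>Y\<^esub> y = y [^]\<^bsub>add_monoid Y\<^esub> nat (a 1)" if "a \<in> carrier (Zp p)" "y \<in> carrier Y" for a y
    using smult_mod_p_cok that unfolding Y_def .
  have card_F: "card (carrier (Fp_vec p m)) = p ^ m" by (simp add: carrier_Fp_vec card_PiE)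
  have "module_isomorphic (Zp p) Y (Fp_vec p m) \<longleftrightarrow> card (carrier Y) = p ^ m"
  proof
    assume "module_isomorphic (Zp p) Y (Fp_vec p m)"
    then show "card (carrier Y) = p ^ m"
      unfolding card_F[symmetric] by (auto simp: module_isomorphic_def iso_def dest: bij_betw_same_card)
  next
    assume card: "card (carrier Y) = p ^ m"
    have "finite (carrier (add_monoid Y))" using Y_pos card_ge_0_finite by simp
    then obtain k c where c: "c \<in> {1..k} \<rightarrow> carrier (add_monoid Y)" "Y.independent k c"
      "Y.span k c = carrier (add_monoid Y)"
      using Y.ex_independent_spanning by metis
    have "p ^ k = p ^ m" using Y.independent_iff_card_span[OF c(1)] c card by simp
    then have km: "k = m" using prime_gt_1_nat[OF prime_p] by simp
    interpret F: elementary_group "Fp_group p m" p by (rule elementary_group_Fp_vec)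
    have "Y.lincomb m c \<in> iso (Fp_group p m) (add_monoid Y)"
    proof (rule isoI)
      show "Y.lincomb m c \<in> hom (Fp_group p m) (add_monoid Y)"
      proof (rule homI)
        fix a b
        have "a \<otimes>\<^bsub>Fp_group p m\<^esub> b = (\<lambda>j\<in>{1..m}. (a j + b j) mod int p)"
          by (simp add: coord_module_def residue_ring_def)
        then show "Y.lincomb m c (a \<otimes>\<^bsub>Fp_group p m\<^esub> b) = Y.lincomb m c a \<otimes>\<^bsub>add_monoid Y\<^esub> Y.lincomb m c b"
          using Y.lincomb_mod[OF c(1)] Y.lincomb_add[OF c(1)] km by metis
      next
        fix a
        show "Y.lincomb m c a \<in> carrier (add_monoid Y)" using c(1) km by (intro Y.lincomb_closed) simp
      qed
      show "bij_betw (Y.lincomb m c) (carrier (Fp_group p m)) (carrier (add_monoid Y))"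
        using Y.independent_iff_inj_on[OF c(1)] Y.span_conv_coeffs[OF c(1)] c km
        by (simp add: bij_betw_def carrier_Fp_vec)
    qed
    then obtain f where f: "f \<in> iso (add_monoid Y) (Fp_group p m)" using F.iso_set_sym by blast
    have "f (a \<odot>\<^bsub>Y\<^esub> y) = a \<odot>\<^bsub>Fp_vec p m\<^esub> f y" if a: "a \<in> carrier (Zp p)" and y: "y \<in> carrier Y" for a y
    proof -
      have fy: "f y \<in> carrier (Fp_vec p m)" using f y by (auto simp: iso_def hom_def)
      have a1: "0 \<le> a 1" using Zp_eval_1[OF a] by simp
      have "f (a \<odot>\<^bsub>Y\<^esub> y) = f y [^]\<^bsub>Fp_group p m\<^esub> nat (a 1)"
        unfolding smult[OF a y] using f y
        by (intro hom_nat_pow[OF _ _ Y.is_group F.is_group]) (simp_all add: iso_def)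
      also have "\<dots> = a \<odot>\<^bsub>Fp_vec p m\<^esub> f y"
      proof
        fix i
        show "(f y [^]\<^bsub>Fp_group p m\<^esub> nat (a 1)) i = (a \<odot>\<^bsub>Fp_vec p m\<^esub> f y) i"
        proof (cases "i \<in> {1..m}")
          case True
          then show ?thesis
            using Fp_vec_pow[OF fy True, of "nat (a 1)"] a1
            by (simp add: coord_module_def residue_ring_def del: pow_nat)
        next
          case False
          have "f y [^]\<^bsub>Fp_group p m\<^esub> nat (a 1) \<in> carrier (Fp_group p m)" using fy by (intro F.nat_pow_closed) simp
          then have "f y [^]\<^bsub>Fp_group p m\<^esub> nat (a 1) \<in> extensional {1..m}"
            by (simp add: carrier_Fp_vec PiE_iff del: pow_nat)
          moreover have "a \<odot>\<^bsub>Fp_vec p m\<^esub> f y \<in> extensional {1..m}" by (simp add: coord_module_def)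
          ultimately show ?thesis using extensional_arb[OF _ False] by metis
        qed
      qed
      finally show ?thesis .
    qed
    then show "module_isomorphic (Zp p) Y (Fp_vec p m)" unfolding module_isomorphic_def using f by blast
  qed
  also have "\<dots> \<longleftrightarrow> p ^ m * s = card (carrier Y) * s" using s_pos mult_cancel2[of "p ^ m" s "card (carrier Y)"] by (metis less_irrefl)
  also have "\<dots> \<longleftrightarrow> s * p ^ m = p ^ n" unfolding card_Y by (simp add: mult.commute)
  finally show ?thesis unfolding Y_def s_def .
qed

end

section \<open>The law of the matrix of residues\<close>

lemma measure_haar_entry_ball:
  assumes "b \<in> {0..<int p}"
  shows "measure (haar_entry p \<sigma> (i, j)) (Zp_ball p 1 b)
       = (if i \<in> \<sigma> j then 1 / real p else if b = 0 then 1 else 0)"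
proof (cases "i \<in> \<sigma> j")
  case True
  have "emeasure (haar p) (Zp_ball p 1 b) = ennreal (1 / real p)"
    using haar_prob_ball[OF p_pos is_haar_prob_haar[OF p_pos], of b 1] assms by simp
  then show ?thesis using True by (simp add: haar_entry_def measure_def)
next
  case False
  have "\<zero>\<^bsub>Zp p\<^esub> \<in> Zp_ball p 1 b \<longleftrightarrow> b = 0"
    using Zp_zero[OF p_pos] by (auto simp: Zp_ball_def[OF p_pos]) (simp_all add: Zp_def)
  then show ?thesis using False Zp_ball_sets[OF p_pos, of 1 b]
    by (simp add: haar_entry_def measure_return indicator_def)
qed

text \<open>
  The entries on the support have independent uniform residues and the others are almost surely
  \<open>0\<close>, so every supported matrix of residues occurs with the same probability. Entries off the
  support vanish only almost surely, which is why the event is decomposed over all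
  matrices of residues; the matrices that are not supported then contribute null sets.
\<close>

lemma measure_haar_matrix_residues:
  fixes n :: nat and \<sigma> :: "nat \<Rightarrow> nat set" and Q :: "(nat \<times> nat \<Rightarrow> int) \<Rightarrow> bool"
  defines "I \<equiv> {1..n} \<times> {1..n}"
  shows "measure (haar_matrix p n \<sigma>) {X \<in> space (haar_matrix p n \<sigma>). Q (\<lambda>ij\<in>I. X ij 1)}
       = card {B \<in> supported_matrices p n \<sigma>. Q B} / real p ^ card {(i, j) \<in> I. i \<in> \<sigma> j}"
proof -
  let ?M = "haar_matrix p n \<sigma>" and ?J = "{(i, j) \<in> I. i \<in> \<sigma> j}"
  note pp = p_pos
  have I: "finite I" by (simp add: I_def)
  have sp: "space (haar_entry p \<sigma> ij) = carrier (Zp p)" for ij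
    using sets_eq_imp_space_eq[OF sets_haar_entry[OF pp]] space_Zp_borel[OF pp] by simp
  have spM: "space ?M = I \<rightarrow>\<^sub>E carrier (Zp p)"
    by (simp add: haar_matrix_def I_def[symmetric] space_PiM sp)
  interpret product_prob_space "haar_entry p \<sigma>" I
    by (intro product_prob_space.intro product_sigma_finite.intro product_prob_space_axioms.intro
        prob_space_imp_sigma_finite prob_space_haar_entry[OF pp])
  \<comment> \<open>The event that the matrix of residues is \<open>B\<close>; it is a box.\<close>
  define E where "E B = (\<Pi>\<^sub>E ij\<in>I. Zp_ball p 1 (B ij))" for B
  define S where "S = {B \<in> I \<rightarrow>\<^sub>E {0..<int p}. Q B}"
  have S: "finite S" unfolding S_def using I by (intro finite_subset[OF _ finite_PiE[of I "\<lambda>_. {0..<int p}"]]) auto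
  have ball: "Zp_ball p 1 b \<in> sets (haar_entry p \<sigma> ij)" for b ij
    using Zp_ball_sets[OF pp] sets_haar_entry[OF pp] by simp
  have meas: "measure ?M (E B) = (\<Prod>ij\<in>I. measure (haar_entry p \<sigma> ij) (Zp_ball p 1 (B ij)))" for B
  proof -
    have "prod_emb I (haar_entry p \<sigma>) I (E B) = E B"
      unfolding E_def using ball by (intro prod_emb_PiE_same_index sets.sets_into_space)
    then show ?thesis
      using measure_PiM_emb[of I "\<lambda>ij. Zp_ball p 1 (B ij)"] I ball
      unfolding haar_matrix_def E_def I_def[symmetric] by simp
  qed
  have setsE: "E B \<in> sets ?M" for B
    unfolding E_def haar_matrix_def I_def[symmetric] using I ball by (intro sets_PiM_I_finite)
  have "{X \<in> space ?M. Q (\<lambda>ij\<in>I. X ij 1)} = (\<Union>B\<in>S. E B)"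
  proof (intro equalityI subsetI)
    fix X assume X: "X \<in> {X \<in> space ?M. Q (\<lambda>ij\<in>I. X ij 1)}"
    have "(\<lambda>ij\<in>I. X ij 1) \<in> S"
      using X Zp_eval_1 by (fastforce simp: S_def spM PiE_iff)
    moreover have "X \<in> E (\<lambda>ij\<in>I. X ij 1)"
      using X by (auto simp: E_def spM PiE_iff Zp_ball_def[OF pp])
    ultimately show "X \<in> (\<Union>B\<in>S. E B)" by blast
  next
    fix X assume "X \<in> (\<Union>B\<in>S. E B)"
    then obtain B where B: "B \<in> S" "X \<in> E B" by blast
    then have "(\<lambda>ij\<in>I. X ij 1) = B"
      by (auto simp: S_def E_def PiE_iff Zp_ball_def[OF pp] fun_eq_iff extensional_def)
    moreover have "X \<in> space ?M" using B(2) by (auto simp: E_def spM PiE_iff Zp_ball_def[OF pp])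
    ultimately show "X \<in> {X \<in> space ?M. Q (\<lambda>ij\<in>I. X ij 1)}" using B(1) by (simp add: S_def)
  qed
  moreover have "disjoint_family_on E S"
  proof (unfold disjoint_family_on_def, intro ballI impI)
    fix B C assume BC: "B \<in> S" "C \<in> S" "B \<noteq> C"
    show "E B \<inter> E C = {}"
    proof (rule ccontr)
      assume "E B \<inter> E C \<noteq> {}"
      then obtain X where "X \<in> E B" "X \<in> E C" by blast
      then have "B ij = C ij" if "ij \<in> I" for ij
        using that by (auto simp: E_def PiE_iff Zp_ball_def[OF pp])
      then have "B = C" using BC(1,2) unfolding S_def by (intro PiE_ext[of B I _ C]) auto
      then show False using BC(3) by simp
    qed
  qed
  moreover have "prob_space ?M" using pp by (rule prob_space_haar_matrix)
  ultimately have "measure ?M {X \<in> space ?M. Q (\<lambda>ij\<in>I. X ij 1)} = (\<Sum>B\<in>S. measure ?M (E B))"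
    using S setsE by (simp only:) (intro finite_measure.finite_measure_finite_Union prob_space.finite_measure; auto)
  also have "\<dots> = (\<Sum>B\<in>S. if B \<in> supported_matrices p n \<sigma> then 1 / real p ^ card ?J else 0)"
  proof (rule sum.cong[OF refl])
    fix B assume B: "B \<in> S"
    have "measure ?M (E B) = (\<Prod>(i, j)\<in>I. if i \<in> \<sigma> j then 1 / real p else if B (i, j) = 0 then 1 else 0)"
      unfolding meas using B by (intro prod.cong) (auto simp: S_def PiE_iff measure_haar_entry_ball)
    also have "\<dots> = (if B \<in> supported_matrices p n \<sigma> then 1 / real p ^ card ?J else 0)"
    proof (cases "B \<in> supported_matrices p n \<sigma>")
      case True
      then have "(\<Prod>(i, j)\<in>I. if i \<in> \<sigma> j then 1 / real p else if B (i, j) = 0 then 1 else 0)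
          = (\<Prod>ij\<in>I. if ij \<in> ?J then 1 / real p else 1)"
        by (intro prod.cong refl) (force simp: supported_matrices_def I_def split_beta mem_Times_iff)
      also have "\<dots> = (\<Prod>ij\<in>I \<inter> ?J. 1 / real p)" using I by (rule prod.inter_restrict[symmetric])
      also have "I \<inter> ?J = ?J" by auto
      finally show ?thesis using True by (simp add: power_one_over)
    next
      case False
      then obtain i j where ij: "(i, j) \<in> I" "i \<notin> \<sigma> j" "B (i, j) \<noteq> 0"
        using B by (auto simp: supported_matrices_def S_def I_def)
      then have "(\<Prod>(i, j)\<in>I. if i \<in> \<sigma> j then 1 / real p else if B (i, j) = 0 then 1 else 0) = (0::real)"
        using I by (intro prod_zero) (auto intro!: bexI[of _ "(i, j)"])
      with False show ?thesis by simp
    qed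
    finally show "measure ?M (E B) = (if B \<in> supported_matrices p n \<sigma> then 1 / real p ^ card ?J else 0)" .
  qed
  also have "\<dots> = (\<Sum>B\<in>S \<inter> supported_matrices p n \<sigma>. 1 / real p ^ card ?J)"
    using S by (rule sum.inter_restrict[symmetric])
  also have "S \<inter> supported_matrices p n \<sigma> = {B \<in> supported_matrices p n \<sigma>. Q B}"
    by (auto simp: S_def supported_matrices_def I_def)
  also have "(\<Sum>B\<in>{B \<in> supported_matrices p n \<sigma>. Q B}. 1 / real p ^ card ?J)
      = card {B \<in> supported_matrices p n \<sigma>. Q B} / real p ^ card ?J" by simp
  finally show ?thesis .
qed

lemma prob_cok_rank:
  fixes n :: nat and \<sigma> :: "nat \<Rightarrow> nat set"
  shows "measure (haar_matrix p n \<sigma>) {X \<in> space (haar_matrix p n \<sigma>).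
           module_isomorphic (Zp p) (mod_p p (cok p n X)) (Fp_vec p m)}
       = card {B \<in> supported_matrices p n \<sigma>.
            card (elementary_group.span (Fp_group p n) n (matrix_column n B)) * p ^ m = p ^ n}
         / real p ^ card {(i, j) \<in> {1..n} \<times> {1..n}. i \<in> \<sigma> j}"
proof -
  note pp = p_pos
  interpret F: elementary_group "Fp_group p n" p by (rule elementary_group_Fp_vec)
  have sp: "space (haar_matrix p n \<sigma>) = {1..n} \<times> {1..n} \<rightarrow>\<^sub>E carrier (Zp p)"
    using sets_eq_imp_space_eq[OF sets_haar_entry[OF pp]] space_Zp_borel[OF pp]
    by (simp add: haar_matrix_def space_PiM)
  have "module_isomorphic (Zp p) (mod_p p (cok p n X)) (Fp_vec p m) \<longleftrightarrow>
      card (F.span n (matrix_column n (\<lambda>ij\<in>{1..n} \<times> {1..n}. X ij 1))) * p ^ m = p ^ n"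
    if "X \<in> space (haar_matrix p n \<sigma>)" for X
  proof -
    have X: "X \<in> {1..n} \<times> {1..n} \<rightarrow> carrier (Zp p)" using that by (auto simp: sp)
    have "F.span n (column n X) = F.span n (matrix_column n (\<lambda>ij\<in>{1..n} \<times> {1..n}. X ij 1))"
      using column_closed[OF X]
      by (intro F.independent_cong(2)) (auto simp: column_def matrix_column_def reduce_def fun_eq_iff)
    then show ?thesis using module_isomorphic_mod_p_cok_iff[OF X] by simp
  qed
  then have eq: "{X \<in> space (haar_matrix p n \<sigma>). module_isomorphic (Zp p) (mod_p p (cok p n X)) (Fp_vec p m)}
    = {X \<in> space (haar_matrix p n \<sigma>).
        card (F.span n (matrix_column n (\<lambda>ij\<in>{1..n} \<times> {1..n}. X ij 1))) * p ^ m = p ^ n}"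
    by blast
  show ?thesis unfolding eq by (rule measure_haar_matrix_residues)
qed

section \<open>Nested supports\<close>

context
  fixes n N :: nat and s :: "nat \<Rightarrow> nat" and \<sigma> :: "nat \<Rightarrow> nat set"
  assumes N: "N \<le> n"
    and s_ge: "\<And>j. j \<in> {1..N} \<Longrightarrow> j \<le> s j" and s_le: "\<And>j. j \<in> {1..N} \<Longrightarrow> s j \<le> n"
    and s_mono: "\<And>j. 1 \<le> j \<Longrightarrow> j < N \<Longrightarrow> s j \<le> s (Suc j)"
    and \<sigma>: "\<And>j. j \<in> {1..n} \<Longrightarrow> \<sigma> j = (if j \<le> N then {1..s j} else {})"
begin

interpretation F: elementary_group "Fp_group p n" p by (rule elementary_group_Fp_vec)

lemma matrix_column_closed:
  assumes "B \<in> supported_matrices p n \<sigma>"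
  shows "matrix_column n B \<in> {1..n} \<rightarrow> carrier (Fp_group p n)"
  using assms by (auto simp: supported_matrices_def matrix_column_def carrier_Fp_vec PiE_iff)

text \<open>
  The columns after the \<open>N\<close>-th have empty support.
\<close>

lemma span_supported:
  assumes B: "B \<in> supported_matrices p n \<sigma>"
  shows "F.span n (matrix_column n B) = F.span N (matrix_column n B)"
proof -
  have "matrix_column n B j = \<one>\<^bsub>Fp_group p n\<^esub>" if "N < j" "j \<le> n" for j
    using that B \<sigma>[of j] by (auto simp: matrix_column_def supported_matrices_def coord_module_def residue_ring_def fun_eq_iff)
  then have "F.lincomb n (matrix_column n B) = F.lincomb N (matrix_column n B)"
    using N matrix_column_closed[OF B] F.lincomb_append_ones by blast
  then show ?thesis by (simp add: F.span_def)
qed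

text \<open>
  The \<open>N < n\<close> columns that are not identically zero cannot span \<open>\<bbbF>\<^sub>p\<^sup>n\<close>.
\<close>

lemma prob_cok_rank_0_nested:
  assumes "N < n"
  shows "measure (haar_matrix p n \<sigma>) {X \<in> space (haar_matrix p n \<sigma>).
           module_isomorphic (Zp p) (mod_p p (cok p n X)) (Fp_vec p 0)} = 0"
proof -
  have "card (F.span n (matrix_column n B)) \<noteq> p ^ n" if B: "B \<in> supported_matrices p n \<sigma>" for B
  proof -
    have "matrix_column n B \<in> {1..N} \<rightarrow> carrier (Fp_group p n)"
      using matrix_column_closed[OF B] N by (auto simp: Pi_iff)
    then have "card (F.span n (matrix_column n B)) \<le> p ^ N"
      unfolding span_supported[OF B] by (rule F.card_span_le)
    also have "\<dots> < p ^ n" using assms prime_gt_1_nat[OF prime_p] by simp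
    finally show ?thesis by simp
  qed
  then have "{B \<in> supported_matrices p n \<sigma>. card (F.span n (matrix_column n B)) * p ^ 0 = p ^ n} = {}"
    by auto
  then show ?thesis unfolding prob_cok_rank by (simp only: card.empty of_nat_0 div_0)
qed

lemma card_support: "card {(i, j) \<in> {1..n} \<times> {1..n}. i \<in> \<sigma> j} = (\<Sum>j=1..N. s j)"
proof -
  have "{(i, j) \<in> {1..n} \<times> {1..n}. i \<in> \<sigma> j} = (\<lambda>(j, i). (i, j)) ` (SIGMA j:{1..N}. {1..s j})"
    using N s_le by (fastforce simp: \<sigma> split: if_splits)
  also have "card \<dots> = card (SIGMA j:{1..N}. {1..s j})" by (rule card_image) (auto simp: inj_on_def)
  also have "\<dots> = (\<Sum>j=1..N. s j)" by (subst card_SigmaI) auto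
  finally show ?thesis .
qed

text \<open>
  The values that column \<open>j\<close> can take modulo \<open>p\<close>. These subgroups increase with \<open>j\<close> because the
  supports are nested.
\<close>

definition "allowed_columns j = {v \<in> carrier (Fp_group p n). \<forall>i\<in>{1..n}. i > s j \<longrightarrow> v i = 0}"

lemma Fp_group_mult: "i \<in> {1..n} \<Longrightarrow> (v \<otimes>\<^bsub>Fp_group p n\<^esub> w) i = (v i + w i) mod int p"
  by (simp add: coord_module_def residue_ring_def)

lemma finite_Fp_group: "finite (carrier (Fp_group p n))"
  by (simp add: carrier_Fp_vec finite_PiE)

lemma subgroup_allowed_columns: "subgroup (allowed_columns j) (Fp_group p n)"
proof (rule F.subgroupI)
  show "allowed_columns j \<subseteq> carrier (Fp_group p n)" by (auto simp: allowed_columns_def)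
  have "\<one>\<^bsub>Fp_group p n\<^esub> \<in> allowed_columns j" using F.one_closed by (simp add: allowed_columns_def Fp_vec_zero)
  then show "allowed_columns j \<noteq> {}" by blast
  show "inv\<^bsub>Fp_group p n\<^esub> v \<in> allowed_columns j" if v: "v \<in> allowed_columns j" for v
  proof -
    have "v \<in> carrier (Fp_group p n)" using v by (simp add: allowed_columns_def)
    then show ?thesis
      using v F.inv_eq_pow[of v] F.nat_pow_closed[of v "p - 1"] Fp_vec_pow[of v n]
      by (simp add: allowed_columns_def)
  qed
  fix v w assume "v \<in> allowed_columns j" "w \<in> allowed_columns j"
  then show "v \<otimes>\<^bsub>Fp_group p n\<^esub> w \<in> allowed_columns j" using F.m_closed[of v w] by (simp add: allowed_columns_def Fp_group_mult[simplified])
qed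

lemma card_allowed_columns:
  assumes "j \<in> {1..N}"
  shows "card (allowed_columns j) = p ^ s j"
proof -
  have c: "carrier (Fp_group p n) = {1..n} \<rightarrow>\<^sub>E {0..<int p}" by (simp add: carrier_Fp_vec)
  have S: "x \<in> (if i \<le> s j then {0..<int p} else {0}) \<longleftrightarrow> x \<in> {0..<int p} \<and> (i > s j \<longrightarrow> x = 0)" for x i
    using p_pos by auto
  have "allowed_columns j = (\<Pi>\<^sub>E i\<in>{1..n}. if i \<le> s j then {0..<int p} else {0})"
    by (rule Set.set_eqI) (unfold allowed_columns_def c mem_Collect_eq PiE_iff S, blast)
  then have "card (allowed_columns j) = (\<Prod>i\<in>{1..n}. if i \<le> s j then p else 1)"
    by (simp add: card_PiE) (auto intro!: prod.cong)
  also have "\<dots> = (\<Prod>i\<in>{1..n} \<inter> {1..s j}. p)"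
    by (subst prod.inter_restrict) (auto intro!: prod.cong)
  also have "{1..n} \<inter> {1..s j} = {1..s j}" using s_le[OF assms] by auto
  finally show ?thesis by simp
qed

text \<open>
  A supported matrix is determined by its first \<open>N\<close> columns, and its column span has \<open>p\<^sup>N\<close> elements
  exactly when these are independent. This reduces the count to tuples in an increasing chain of subgroups.
\<close>

lemma card_independent_supported:
  "card {B \<in> supported_matrices p n \<sigma>. card (F.span n (matrix_column n B)) * p ^ (n - N) = p ^ n}
     = (\<Prod>j=1..N. p ^ s j - p ^ (j - 1))"
proof -
  let ?S = "{B \<in> supported_matrices p n \<sigma>. card (F.span n (matrix_column n B)) * p ^ (n - N) = p ^ n}"
  let ?T = "{c \<in> {1..N} \<rightarrow>\<^sub>E carrier (Fp_group p n). (\<forall>j\<in>{1..N}. c j \<in> allowed_columns j) \<and> F.independent N c}"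
  let ?f = "\<lambda>B. \<lambda>j\<in>{1..N}. matrix_column n B j"
  let ?g = "\<lambda>c. \<lambda>(i, j)\<in>{1..n} \<times> {1..n}. if j \<le> N then c j i else 0"
  \<comment> \<open>The cardinality condition of corank \<open>n - N\<close> is independence of the first \<open>N\<close> columns.\<close>
  have mem: "B \<in> ?S \<longleftrightarrow> B \<in> supported_matrices p n \<sigma> \<and> F.independent N (matrix_column n B)" for B
  proof (cases "B \<in> supported_matrices p n \<sigma>")
    case True
    have c: "matrix_column n B \<in> {1..N} \<rightarrow> carrier (Fp_group p n)"
      using matrix_column_closed[OF True] N by (auto simp: Pi_iff)
    have "p ^ n = p ^ N * p ^ (n - N)" using N by (simp flip: power_add)
    then show ?thesis
      using True p_pos by (simp add: span_supported F.independent_iff_card_span[OF c])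
  qed simp
  have indep: "F.independent N c = F.independent N d"
    if "d \<in> {1..N} \<rightarrow> carrier (Fp_group p n)" "\<And>j. j \<in> {1..N} \<Longrightarrow> c j = d j" for c d
    using F.independent_cong(1)[OF that(1), of c] that(2) by simp
  have "bij_betw ?f ?S ?T"
  proof (rule bij_betw_byWitness[where f' = ?g])
    show "\<forall>B\<in>?S. ?g (?f B) = B"
    proof
      fix B assume B: "B \<in> ?S"
      show "?g (?f B) = B"
      proof (rule PiE_ext)
        show "?g (?f B) \<in> {1..n} \<times> {1..n} \<rightarrow>\<^sub>E UNIV" by auto
        show "B \<in> {1..n} \<times> {1..n} \<rightarrow>\<^sub>E UNIV" using B by (auto simp: supported_matrices_def)
        fix ij assume "ij \<in> {1..n} \<times> {1..n}"
        then show "?g (?f B) ij = B ij"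
          using B by (auto simp: supported_matrices_def matrix_column_def \<sigma>)
      qed
    qed
    show "\<forall>c\<in>?T. ?f (?g c) = c"
    proof
      fix c assume c: "c \<in> ?T"
      show "?f (?g c) = c"
      proof (rule PiE_ext)
        show "?f (?g c) \<in> {1..N} \<rightarrow>\<^sub>E UNIV" by auto
        show "c \<in> {1..N} \<rightarrow>\<^sub>E UNIV" using c by auto
        fix j assume j: "j \<in> {1..N}"
        then have "c j \<in> {1..n} \<rightarrow>\<^sub>E {0..<int p}" using c by (auto simp: carrier_Fp_vec)
        then show "?f (?g c) j = c j"
          using j N by (auto simp: matrix_column_def fun_eq_iff PiE_iff extensional_def)
      qed
    qed
    show "?f ` ?S \<subseteq> ?T"
    proof (rule image_subsetI)
      fix B assume "B \<in> ?S"
      then have B: "B \<in> supported_matrices p n \<sigma>" and I: "F.independent N (matrix_column n B)"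
        using mem by blast+
      have c: "matrix_column n B \<in> {1..N} \<rightarrow> carrier (Fp_group p n)"
        using matrix_column_closed[OF B] N by (auto simp: Pi_iff)
      have "F.independent N (?f B)" using I indep[OF c, of "?f B"] by simp
      moreover have "matrix_column n B j \<in> allowed_columns j" if j: "j \<in> {1..N}" for j
        using c j B N by (auto simp: allowed_columns_def matrix_column_def supported_matrices_def \<sigma> Pi_iff)
      ultimately show "?f B \<in> ?T" using c by auto
    qed
    show "?g ` ?T \<subseteq> ?S"
    proof (rule image_subsetI)
      fix c assume c: "c \<in> ?T"
      have cF: "c j \<in> {1..n} \<rightarrow>\<^sub>E {0..<int p}" "c j \<in> allowed_columns j" if "j \<in> {1..N}" for j
        using c that by (auto simp: carrier_Fp_vec)
      have "?g c (i, j) \<in> {0..<int p} \<and> (i \<notin> \<sigma> j \<longrightarrow> ?g c (i, j) = 0)"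
        if i: "i \<in> {1..n}" and j: "j \<in> {1..n}" for i j
      proof (cases "j \<le> N")
        case True
        then have "c j i \<in> {0..<int p}" "i > s j \<longrightarrow> c j i = 0"
          using cF[of j] i j by (auto simp: allowed_columns_def)
        then show ?thesis using True i j by (auto simp: \<sigma>)
      qed (use i j p_pos in auto)
      then have "?g c \<in> supported_matrices p n \<sigma>"
        unfolding supported_matrices_def by (auto simp: PiE_iff)
      moreover have "matrix_column n (?g c) j = c j" if "j \<in> {1..N}" for j
        using that N cF(1)[OF that] by (auto simp: matrix_column_def fun_eq_iff PiE_iff extensional_def)
      then have "F.independent N (matrix_column n (?g c))"
        using c indep[of c "matrix_column n (?g c)"] by auto
      ultimately show "?g c \<in> ?S" using mem by blast
    qed
  qed
  then have "card ?S = card ?T" by (rule bij_betw_same_card)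
  also have "\<dots> = (\<Prod>j=1..N. card (allowed_columns j) - p ^ (j - 1))"
  proof (rule F.card_independent_tuples)
    show "subgroup (allowed_columns j) (Fp_group p n)" for j by (rule subgroup_allowed_columns)
    show "finite (allowed_columns j)" for j unfolding allowed_columns_def using finite_Fp_group by simp
    show "allowed_columns j \<subseteq> allowed_columns (Suc j)" if "1 \<le> j" "j < N" for j
      using s_mono[OF that] by (auto simp: allowed_columns_def)
  qed
  also have "\<dots> = (\<Prod>j=1..N. p ^ s j - p ^ (j - 1))" by (intro prod.cong) (simp_all add: card_allowed_columns)
  finally show ?thesis .
qed

text \<open>
  There are \<open>p\<^sup>s\<close> equally likely matrices of residues, where \<open>s\<close> is the sum of the \<open>s j\<close>. Distributing the
  powers over the columns turns the number of independent choices into one factor per column.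
\<close>

theorem prob_cok_rank_nested:
  "measure (haar_matrix p n \<sigma>) {X \<in> space (haar_matrix p n \<sigma>).
           module_isomorphic (Zp p) (mod_p p (cok p n X)) (Fp_vec p (n - N))}
     = (\<Prod>j=1..N. 1 - inverse (real p ^ (s j + 1 - j)))"
proof -
  have p0: "real p > 0" using p_pos by simp
  have "real (\<Prod>j=1..N. p ^ s j - p ^ (j - 1)) / real p ^ (\<Sum>j=1..N. s j)
      = (\<Prod>j=1..N. real (p ^ s j - p ^ (j - 1)) / real p ^ s j)"
    by (simp add: prod_dividef power_sum)
  also have "\<dots> = (\<Prod>j=1..N. 1 - inverse (real p ^ (s j + 1 - j)))"
  proof (rule prod.cong[OF refl])
    fix j assume j: "j \<in> {1..N}"
    have "p ^ (j - 1) \<le> p ^ s j" using s_ge[OF j] p_pos by (intro power_increasing) auto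
    then have "real (p ^ s j - p ^ (j - 1)) / real p ^ s j = 1 - real p ^ (j - 1) / real p ^ s j"
      using p0 by (simp add: of_nat_diff field_simps)
    also have "s j = (j - 1) + (s j + 1 - j)" using s_ge[OF j] j by simp
    then have "real p ^ s j = real p ^ (j - 1) * real p ^ (s j + 1 - j)" by (metis power_add)
    then have "real p ^ (j - 1) / real p ^ s j = inverse (real p ^ (s j + 1 - j))"
      using p0 by (simp add: field_simps)
    finally show "real (p ^ s j - p ^ (j - 1)) / real p ^ s j = 1 - inverse (real p ^ (s j + 1 - j))" .
  qed
  finally show ?thesis unfolding prob_cok_rank card_independent_supported card_support .
qed

end

end

section \<open>Greedy products\<close>

text \<open>
  The state is the index of the next factor together with the product of the factors used so far.
  With \<open>F k\<close> the product of all factors from \<open>k\<close> on, \<open>Q * x k * F k\<close> is the limit that results if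
  \<open>x k\<close> is used now and once more before moving on for good.
\<close>

primrec greedy :: "(nat \<Rightarrow> real) \<Rightarrow> (nat \<Rightarrow> real) \<Rightarrow> real \<Rightarrow> nat \<Rightarrow> nat \<Rightarrow> nat \<times> real" where
  "greedy x F T k0 0 = (k0, 1)"
| "greedy x F T k0 (Suc i) =
     (let (k, Q) = greedy x F T k0 i
      in (if T \<le> Q * x k * F k then k else Suc k, Q * x k))"

text \<open>
  Let \<open>Q i\<close> be the partial product. The quantity \<open>Q i * F (e i)\<close>, the limit obtained if no factor
  is ever repeated again, stays at least \<open>T\<close>. An index cannot be kept forever, since the partial products
  would tend to \<open>0\<close>. Whenever an index \<open>k\<close> is left, one more repetition would have pushed the limit
  below \<open>T\<close>, that is \<open>Q * F k < T\<close> for the product \<open>Q\<close> after the step. As \<open>F k\<close> tends to \<open>1\<close>, these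
  two bounds squeeze the decreasing sequence \<open>Q\<close> to \<open>T\<close>.
\<close>

lemma greedy_product:
  fixes x F :: "nat \<Rightarrow> real"
  assumes x: "\<And>k. k \<ge> k0 \<Longrightarrow> 0 < x k" "\<And>k. k \<ge> k0 \<Longrightarrow> x k < 1"
    and F: "\<And>k. k \<ge> k0 \<Longrightarrow> F k = x k * F (Suc k)" "F \<longlonglongrightarrow> 1"
    and T: "0 < T" "T \<le> F k0"
  obtains e :: "nat \<Rightarrow> nat" where "e 0 = k0" "\<And>i. e (Suc i) = e i \<or> e (Suc i) = Suc (e i)"
    "(\<lambda>n. \<Prod>i<n. x (e i)) \<longlonglongrightarrow> T"
proof -
  define e where "e i = fst (greedy x F T k0 i)" for i
  define Q where "Q i = snd (greedy x F T k0 i)" for i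
  have e0: "e 0 = k0" and Q0: "Q 0 = 1" by (simp_all add: e_def Q_def)
  have eS: "e (Suc i) = (if T \<le> Q i * x (e i) * F (e i) then e i else Suc (e i))"
    and QS: "Q (Suc i) = Q i * x (e i)" for i
    by (simp_all add: e_def Q_def Let_def split_beta)
  have Q_eq: "Q n = (\<Prod>i<n. x (e i))" for n
    by (induction n) (simp_all add: Q0 QS)
  have e_ge: "e i \<ge> k0" for i
    by (induction i) (auto simp: e0 eS)
  have e_mono: "incseq e" by (rule incseq_SucI) (simp add: eS)
  have Q_pos: "0 < Q i" for i
    by (induction i) (auto simp: Q0 QS intro!: mult_pos_pos x(1) e_ge)
  \<comment> \<open>Moving on to the next index leaves the quantity unchanged by the recursion for \<open>F\<close>;
    keeping the index is only done if the bound survives.\<close>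
  have inv: "T \<le> Q i * F (e i)" for i
  proof (induction i)
    case 0
    then show ?case using T by (simp add: e0 Q0)
  next
    case (Suc i)
    then show ?case using F(1)[OF e_ge[of i]] by (simp add: eS QS mult.assoc)
  qed
  have unbdd: "\<exists>i. e i \<ge> K" for K
  proof (rule ccontr)
    assume "\<nexists>i. K \<le> e i"
    then have bdd: "e i < K" for i by (meson not_le)
    have "finite (range e)" using bdd by (intro finite_subset[of "range e" "{..<K}"]) auto
    define k where "k = Max (range e)"
    have k: "e i \<le> k" for i unfolding k_def using \<open>finite (range e)\<close> by (intro Max_ge) auto
    have "k \<in> range e" unfolding k_def using \<open>finite (range e)\<close> by (intro Max_in) auto
    then obtain i0 where i0: "e i0 = k" by auto
    have const: "e (i0 + i) = k" for i
      using k[of "i0 + i"] incseqD[OF e_mono, of i0 "i0 + i"] i0 by simp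
    have Qk: "Q (i0 + i) = Q i0 * x k ^ i" for i
      by (induction i) (simp_all add: QS const)
    have kk: "k \<ge> k0" using e_ge[of i0] i0 by simp
    have "(\<lambda>i. Q i0 * x k ^ i * F k) \<longlonglongrightarrow> Q i0 * 0 * F k"
      using x[OF kk] by (intro tendsto_intros LIMSEQ_realpow_zero) auto
    moreover have "T \<le> Q i0 * x k ^ i * F k" for i
      using inv[of "i0 + i"] by (simp add: Qk const)
    ultimately have "T \<le> Q i0 * 0 * F k" by (intro LIMSEQ_le_const) auto
    then show False using T by simp
  qed
  have e_top: "filterlim e at_top sequentially"
    unfolding filterlim_at_top
  proof
    fix K
    obtain i where "e i \<ge> K" using unbdd by blast
    then have "\<forall>j\<ge>i. e j \<ge> K" using incseqD[OF e_mono] order_trans by blast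
    then show "\<forall>\<^sub>F i in sequentially. K \<le> e i" unfolding eventually_sequentially by blast
  qed
  have Q_dec: "Q j \<le> Q i" if "i \<le> j" for i j
  proof -
    have "decseq Q"
    proof (rule decseq_SucI)
      fix i
      have "Q i * x (e i) \<le> Q i * 1"
        using Q_pos[of i] x(2)[OF e_ge[of i]] by (intro mult_left_mono) auto
      then show "Q (Suc i) \<le> Q i" by (simp add: QS)
    qed
    then show ?thesis using that by (rule decseqD)
  qed
  have upper: "\<exists>i. Q (Suc i) * F k < T" if k: "k \<ge> k0" for k
  proof -
    \<comment> \<open>The step before this one is the last use of the index \<open>k\<close>.\<close>
    define i where "i = (LEAST i. e i > k)"
    have ex: "\<exists>i. e i > k" using unbdd[of "Suc k"] by (auto simp: Suc_le_eq)
    have i: "e i > k" unfolding i_def using ex by (rule LeastI_ex)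
    have "i \<noteq> 0" using i k e0 by (metis not_le)
    then obtain j where j: "i = Suc j" by (cases i) auto
    have "e j \<le> k" using not_less_Least[of j "\<lambda>i. e i > k"] j unfolding i_def[symmetric] by simp
    then have "e j = k" "\<not> T \<le> Q j * x (e j) * F (e j)" using i j eS[of j] by (auto split: if_splits)
    then show ?thesis using QS[of j] by (intro exI[of _ j]) simp
  qed
  have "Q \<longlonglongrightarrow> T"
  proof (rule order_tendstoI)
    fix a assume a: "a < T"
    have "(\<lambda>i. F (e i)) \<longlonglongrightarrow> 1" using F(2) e_top by (rule filterlim_compose)
    then have "(\<lambda>i. T / F (e i)) \<longlonglongrightarrow> T / 1" by (intro tendsto_intros) auto
    then have "\<forall>\<^sub>F i in sequentially. a < T / F (e i)" using a by (intro order_tendstoD(1)) auto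
    then show "\<forall>\<^sub>F i in sequentially. a < Q i"
    proof eventually_elim
      case (elim i)
      have "F (e i) > 0" using inv[of i] T Q_pos[of i] by (metis less_le_trans zero_less_mult_pos)
      moreover from this have "a * F (e i) < T" using elim by (simp add: less_divide_eq)
      then have "a * F (e i) < Q i * F (e i)" using inv[of i] by linarith
      ultimately show ?case by simp
    qed
  next
    fix a assume a: "T < a"
    have "(\<lambda>k. T / F k) \<longlonglongrightarrow> T / 1" using F(2) by (intro tendsto_intros) auto
    then have "\<forall>\<^sub>F k in sequentially. T / F k < a" using a by (intro order_tendstoD(2)) auto
    moreover have "\<forall>\<^sub>F k in sequentially. F k > 0" using F(2) by (intro order_tendstoD(1)[of _ 1]) auto
    moreover have "\<forall>\<^sub>F k in sequentially. k \<ge> k0" by (rule eventually_ge_at_top)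
    ultimately have "\<forall>\<^sub>F k in sequentially. T / F k < a \<and> F k > 0 \<and> k \<ge> k0" by eventually_elim auto
    then obtain k where k: "T / F k < a" "F k > 0" "k \<ge> k0" by (auto dest: eventually_happens)
    obtain i where "Q (Suc i) * F k < T" using upper[OF k(3)] by blast
    then have "Q (Suc i) < T / F k" using k(2) by (simp add: field_simps)
    then have "Q j < a" if "j \<ge> Suc i" for j using Q_dec[OF that] k(1) by linarith
    then show "\<forall>\<^sub>F i in sequentially. Q i < a" unfolding eventually_sequentially by blast
  qed
  then have "(\<lambda>n. \<Prod>i<n. x (e i)) \<longlonglongrightarrow> T" unfolding Q_eq[symmetric] .
  moreover have "e (Suc i) = e i \<or> e (Suc i) = Suc (e i)" for i by (simp add: eS)
  ultimately show ?thesis using e0 that by blast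
qed

section \<open>Euler products and the Cohen--Lenstra constants\<close>

context
  fixes p :: nat
  assumes p: "p \<ge> 2"
begin

definition "euler_factor k = 1 - inverse (real p ^ k)"

text \<open>
  Both \<open>x\<^sub>k > 0\<close> and \<open>p\<^bsup>-k\<^esup> \<le> x\<^sub>k\<close> come from \<open>p\<^sup>k \<ge> 2\<close>; the latter is what makes \<open>cl(m)\<close> small enough.
\<close>

lemma euler_factor_bounds:
  assumes "k \<ge> 1"
  shows "0 < euler_factor k" "euler_factor k < 1" "inverse (real p ^ k) \<le> euler_factor k"
proof -
  have "2 \<le> real p ^ k" using p assms by (intro order_trans[OF _ self_le_power]) auto
  then have "inverse (real p ^ k) \<le> inverse 2" by (rule le_imp_inverse_le) simp
  moreover have "0 < inverse (real p ^ k)" using p by simp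
  ultimately show "0 < euler_factor k" "euler_factor k < 1" "inverse (real p ^ k) \<le> euler_factor k"
    unfolding euler_factor_def by simp_all
qed

lemma inverse_power_summable: "summable (\<lambda>i. inverse (real p ^ Suc i))"
proof -
  have "summable (\<lambda>i. inverse (real p) * inverse (real p) ^ i)"
    using p by (intro summable_mult summable_geometric) (auto simp: field_simps)
  then show ?thesis by (simp add: power_inverse)
qed

lemma convergent_euler: "convergent_prod (\<lambda>i. euler_factor (Suc i))"
  unfolding euler_factor_def
proof -
  have "abs_convergent_prod (\<lambda>i. 1 + - inverse (real p ^ Suc i))"
    using inverse_power_summable p by (intro summable_imp_abs_convergent_prod) simp
  from abs_convergent_prod_imp_convergent_prod[OF this]
  show "convergent_prod (\<lambda>i. 1 - inverse (real p ^ Suc i))" by simp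
qed

definition "euler_tail k = (\<Prod>i. euler_factor (i + k))"

lemma euler_tail_Suc:
  assumes "k \<ge> 1"
  shows "euler_tail k = euler_factor k * euler_tail (Suc k)"
proof -
  have conv: "convergent_prod (\<lambda>i. euler_factor (i + k))"
    using convergent_prod_ignore_initial_segment[OF convergent_euler, of "k - 1"] assms by simp
  have "(\<Prod>i. euler_factor (Suc i + k)) = euler_tail k / euler_factor (0 + k)"
    unfolding euler_tail_def using conv euler_factor_bounds[OF assms] by (intro prodinf_split_head) simp_all
  then show ?thesis using euler_factor_bounds[OF assms] by (simp add: euler_tail_def)
qed

lemma euler_tail_1_eq: "euler_tail 1 = (\<Prod>i=1..r. euler_factor i) * euler_tail (Suc r)"
proof (induction r)
  case (Suc r)
  then show ?case using euler_tail_Suc[of "Suc r"] by (simp add: mult.assoc)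
qed (simp add: One_nat_def)

lemma euler_tail_1: "euler_tail 1 = (\<Prod>i. euler_factor (Suc i))"
  by (simp add: euler_tail_def One_nat_def)

text \<open>
  A convergent infinite product without zero factors is nonzero.
\<close>

lemma euler_tail_1_pos: "euler_tail 1 > 0"
proof -
  have pos: "0 < euler_factor (Suc i)" for i by (rule euler_factor_bounds(1)) simp
  have "euler_tail 1 \<noteq> 0" unfolding euler_tail_1
    using convergent_euler less_imp_neq[OF pos] by (intro prodinf_nonzero) metis+
  moreover have "euler_tail 1 \<ge> 0" unfolding euler_tail_1
    using convergent_prod_LIMSEQ[OF convergent_euler]
    by (rule LIMSEQ_le_const) (auto intro!: prod_nonneg less_imp_le[OF pos])
  ultimately show ?thesis by simp
qed

text \<open>
  The tails are quotients of the full product, which is nonzero, by its partial products.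
\<close>

lemma euler_tail_lim: "euler_tail \<longlonglongrightarrow> 1"
proof -
  have "(\<lambda>n. \<Prod>i\<le>n. euler_factor (Suc i)) \<longlonglongrightarrow> (\<Prod>i. euler_factor (Suc i))"
    using convergent_euler by (rule convergent_prod_LIMSEQ)
  then have "(\<lambda>n. \<Prod>i=1..Suc n. euler_factor i) \<longlonglongrightarrow> euler_tail 1"
    by (simp only: euler_tail_1 prod.atLeast1_atMost_eq[folded One_nat_def] lessThan_Suc_atMost)
  then have "(\<lambda>n. euler_tail 1 / (\<Prod>i=1..Suc n. euler_factor i)) \<longlonglongrightarrow> euler_tail 1 / euler_tail 1"
    using euler_tail_1_pos by (intro tendsto_intros) auto
  moreover have "euler_tail 1 / (\<Prod>i=1..Suc n. euler_factor i) = euler_tail (Suc (Suc n))" for n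
  proof -
    have "(\<Prod>i=1..Suc n. euler_factor i) > 0" using euler_factor_bounds(1) by (intro prod_pos) auto
    then show ?thesis unfolding euler_tail_1_eq[of "Suc n"]
      by (intro nonzero_mult_div_cancel_left) (rule less_imp_neq[symmetric])
  qed
  ultimately have "(\<lambda>n. euler_tail (Suc (Suc n))) \<longlonglongrightarrow> 1" using euler_tail_1_pos by simp
  then show ?thesis by (intro LIMSEQ_imp_Suc[of euler_tail] LIMSEQ_imp_Suc[of "\<lambda>n. euler_tail (Suc n)"])
qed

lemma cl_eq: "cl p m = inverse (real p ^ m\<^sup>2) * inverse (\<Prod>i=1..m. euler_factor i) * euler_tail (Suc m)"
proof -
  have pos: "(\<Prod>i=1..m. euler_factor i) > 0" using euler_factor_bounds(1) by (intro prod_pos) auto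
  have "cl p m = inverse (real p ^ m\<^sup>2) * (inverse (\<Prod>i=1..m. euler_factor i))\<^sup>2 * euler_tail 1"
    unfolding cl_def euler_tail_1 euler_factor_def[symmetric]
    by (simp add: prod_inversef[symmetric] prod_power_distrib power_inverse comp_def)
  then show ?thesis unfolding euler_tail_1_eq[of m] using pos by (simp add: power2_eq_square field_simps)
qed

text \<open>
  The factor in front of the tail in \<open>cl(m)\<close> is at most \<open>1\<close> because \<open>p\<^bsup>-m*m\<^esup>\<close> is a product of \<open>m\<close>
  factors \<open>p\<^bsup>-m\<^esup>\<close>, each bounded by the corresponding \<open>1 - p\<^bsup>-i\<^esup>\<close>. For \<open>p = 2\<close> and \<open>m = 1\<close> there
  is equality, so the greedy construction has to reach its upper endpoint.
\<close>

lemma cl_bounds: "0 < cl p m" "cl p m \<le> euler_tail (Suc m)"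
proof -
  have pos: "(\<Prod>i=1..m. euler_factor i) > 0" using euler_factor_bounds(1) by (intro prod_pos) auto
  have tail: "euler_tail (Suc m) > 0"
    using euler_tail_1_pos pos unfolding euler_tail_1_eq[of m] by (simp add: zero_less_mult_iff)
  show "0 < cl p m" unfolding cl_eq using pos tail p by simp
  have "inverse (real p ^ m\<^sup>2) \<le> (\<Prod>i=1..m. inverse (real p ^ m))"
    using p by (simp add: power2_eq_square power_mult power_inverse)
  also have "\<dots> \<le> (\<Prod>i=1..m. euler_factor i)"
  proof (rule prod_mono, rule conjI)
    fix i assume i: "i \<in> {1..m}"
    have "inverse (real p ^ m) \<le> inverse (real p ^ i)"
      using i p by (intro le_imp_inverse_le power_increasing) auto
    also have "\<dots> \<le> euler_factor i" using i euler_factor_bounds(3) by simp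
    finally show "inverse (real p ^ m) \<le> euler_factor i" .
  qed simp
  finally have "inverse (real p ^ m\<^sup>2) * inverse (\<Prod>i=1..m. euler_factor i)
      \<le> (\<Prod>i=1..m. euler_factor i) * inverse (\<Prod>i=1..m. euler_factor i)"
    using pos by (intro mult_right_mono) simp_all
  also have "\<dots> = 1" using pos by (intro right_inverse) (rule less_imp_neq[symmetric])
  finally have "inverse (real p ^ m\<^sup>2) * inverse (\<Prod>i=1..m. euler_factor i) \<le> 1" .
  then show "cl p m \<le> euler_tail (Suc m)" unfolding cl_eq using tail by simp
qed

end

section \<open>Supports with a prescribed limiting probability of corank r\<close>

theorem corollary3p3:
  fixes p r :: nat
  assumes "prime p" and "r > 0"
  shows "\<exists>\<sigma> :: nat \<Rightarrow> nat \<Rightarrow> nat set.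
           (\<forall>n\<ge>1. \<forall>j\<in>{1..n}. \<sigma> n j \<subseteq> {1..n}) \<and>
           converges_CL p r (\<lambda>n. haar_matrix p n (\<sigma> n)) (\<lambda>n X. cok p n X) \<and>
           \<not> converges_CL p 0 (\<lambda>n. haar_matrix p n (\<sigma> n)) (\<lambda>n X. cok p n X)"
proof -
  have p2: "p \<ge> 2" using \<open>prime p\<close> by (rule prime_ge_2_nat)
  obtain e :: "nat \<Rightarrow> nat" where e: "e 0 = Suc r" "\<And>i. e (Suc i) = e i \<or> e (Suc i) = Suc (e i)"
    and lim: "(\<lambda>n. \<Prod>i<n. euler_factor p (e i)) \<longlonglongrightarrow> cl p r"
  proof (rule greedy_product[of "Suc r" "euler_factor p" "euler_tail p" "cl p r"])
    show "euler_tail p k = euler_factor p k * euler_tail p (Suc k)" if "k \<ge> Suc r" for k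
      using that by (intro euler_tail_Suc[OF p2]) simp
  qed (use euler_factor_bounds[OF p2] euler_tail_lim[OF p2] cl_bounds[OF p2] in auto)
  have e_bounds: "1 \<le> e i \<and> e i \<le> Suc r + i" for i
  proof (induction i)
    case (Suc i)
    then show ?case using e(2)[of i] by auto
  qed (simp add: e(1))
  then have e_ge: "1 \<le> e i" and e_le: "e i \<le> Suc r + i" for i by blast+
  \<comment> \<open>Column \<open>j\<close> is followed by \<open>n - r - j\<close> further columns before the empty ones, and the
    exponent \<open>s\<^sub>j - j + 1\<close> of its factor has to be the entry of \<open>e\<close> at that position.
    For \<open>n \<le> r\<close> truncated subtraction makes all supports empty.\<close>
  define s where "s n j = e (n - r - j) + j - 1" for n j
  define \<sigma> where "\<sigma> n j = (if j \<le> n - r then {1..s n j} else {})" for n j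
  define P where "P n m = measure (haar_matrix p n (\<sigma> n)) {X \<in> space (haar_matrix p n (\<sigma> n)).
      module_isomorphic (Zp p) (mod_p p (cok p n X)) (Fp_vec p m)}" for n m
  have s_ge: "j \<le> s n j" for n j using e_ge[of "n - r - j"] by (simp add: s_def)
  have s_le: "s n j \<le> n" if "j \<in> {1..n - r}" for n j
    using e_le[of "n - r - j"] that by (auto simp: s_def)
  have s_mono: "s n j \<le> s n (Suc j)" if "j < n - r" for n j
  proof -
    have "n - r - j = Suc (n - r - Suc j)" using that by simp
    then have "e (n - r - j) \<le> Suc (e (n - r - Suc j))" using e(2)[of "n - r - Suc j"] by auto
    then show ?thesis by (simp add: s_def)
  qed
  have \<sigma>: "\<sigma> n j = (if j \<le> n - r then {1..s n j} else {})" for n j by (simp add: \<sigma>_def)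
  have rank_r: "P (n + r) r = (\<Prod>i<n. euler_factor p (e i))" for n
  proof -
    have "P (n + r) (n + r - (n + r - r)) = (\<Prod>j=1..n + r - r. 1 - inverse (real p ^ (s (n + r) j + 1 - j)))"
      unfolding P_def using s_ge s_le s_mono \<sigma>
      by (intro prob_cok_rank_nested[OF \<open>prime p\<close>]) simp_all
    also have "\<dots> = (\<Prod>j=1..n. euler_factor p (e (n - j)))"
    proof (rule prod.cong)
      fix j assume j: "j \<in> {1..n}"
      then have "s (n + r) j + 1 - j = e (n - j)" using e_ge[of "n - j"] by (simp add: s_def)
      then show "1 - inverse (real p ^ (s (n + r) j + 1 - j)) = euler_factor p (e (n - j))"
        by (simp add: euler_factor_def[OF p2])
    qed simp
    also have "\<dots> = (\<Prod>i<n. euler_factor p (e (n - Suc i)))"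
      by (simp only: prod.atLeast1_atMost_eq[folded One_nat_def])
    also have "\<dots> = (\<Prod>i<n. euler_factor p (e i))" by (rule prod.nat_diff_reindex)
    finally show ?thesis by simp
  qed
  have rank_0: "P n 0 = 0" if "n \<ge> 1" for n
    unfolding P_def using s_ge s_le s_mono \<sigma> that \<open>r > 0\<close>
    by (intro prob_cok_rank_0_nested[OF \<open>prime p\<close>, where N = "n - r"]) simp_all
  show ?thesis
  proof (intro exI[of _ \<sigma>] conjI allI impI ballI)
    show "\<sigma> n j \<subseteq> {1..n}" if "j \<in> {1..n}" for n j
      using s_le[of j n] that by (auto simp: \<sigma>)
    have "(\<lambda>n. P n r) \<longlonglongrightarrow> cl p r" by (rule LIMSEQ_offset[of _ r]) (simp add: rank_r lim)
    then show "converges_CL p r (\<lambda>n. haar_matrix p n (\<sigma> n)) (\<lambda>n X. cok p n X)"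
      by (simp add: converges_CL_def P_def)
    show "\<not> converges_CL p 0 (\<lambda>n. haar_matrix p n (\<sigma> n)) (\<lambda>n X. cok p n X)"
    proof
      assume "converges_CL p 0 (\<lambda>n. haar_matrix p n (\<sigma> n)) (\<lambda>n X. cok p n X)"
      then have "(\<lambda>n. P n 0) \<longlonglongrightarrow> cl p 0" by (simp add: converges_CL_def P_def)
      moreover have "(\<lambda>n. P n 0) \<longlonglongrightarrow> 0"
        by (rule tendsto_eventually) (use rank_0 in \<open>auto simp: eventually_sequentially intro!: exI[of _ 1]\<close>)
      ultimately have "cl p 0 = 0" by (rule LIMSEQ_unique)
      then show False using cl_bounds(1)[OF p2, of 0] by simp
    qed
  qed
qed

end
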